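(* Let $f$ be a non-linear metric $f(R)$ gravity model, i.e. $f''(R)\neq 0$. No vacuum exterior metric of the form $$ds^2_+=U(r)\,dt^2-V(t)\,U^{-1}(r)\,dr^2-r^2d\Omega_{(2)}^2$$ can be smoothly matched, in the sense of metric $f(R)$ gravity, to the interior of a collapsing uniform-density dust star.
   Context: Conventions: signature $(+,-,-,-)$, $c=1$, $\kappa=8\pi G>0$, Riemann tensor $R^{\rho}{}_{\sigma\mu\nu}=\partial_\nu\Gamma^\rho_{\sigma\mu}+\Gamma^\rho_{\lambda\nu}\Gamma^\lambda_{\sigma\mu}-(\mu\leftrightarrow\nu)$, $R_{\mu\nu}=R^\lambda{}_{\mu\lambda\nu}$, $R=g^{\mu\nu}R_{\mu\nu}$. $f$ is a smooth real function on an interval, $f_R=f'$. The field equations of metric $f(R)$ gravity are $$f_R(R)R_{\mu\nu}-\tfrac12 f(R)g_{\mu\nu}+(\nabla_\mu\nabla_\nu-g_{\mu\nu}\square)f_R(R)=-\kappa T_{\mu\nu}.$$ Interior (collapsing uniform-density dust star): constants $k\in\mathbb R$, $\rho_0>0$, $\chi_*>0$ with $1-k\chi_*^2>0$, and a smooth scale factor $a(\tau)>0$ on $[0,\tau_c)$ with $a(0)=1$, $\dot a(0)=0$ and $\dot a(\tau)<0$ for $0<\tau<\tau_c$ (collapse). The metric, for $0\le \chi\le\chi_*$, is $$ds_-^2=d\tau^2-a^2(\tau)\left(\frac{d\chi^2}{1-k\chi^2}+\chi^2d\Omega_{(2)}^2\right),$$ and it satisfies the field equations with $T_{\mu\nu}=\rho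 u_\mu u_\nu$, $u=\partial_\tau$, $\rho(\tau)=\rho_0/a^3(\tau)$. Its Ricci scalar is $R^-=6\left(\frac{\dot a^2+k}{a^2}+\frac{\ddot a}{a}\right)$. Exterior: the metric is required to have smooth $U,V>0$ and to solve the field equations with $T_{\mu\nu}=0$. Its Ricci scalar is denoted $R^+$. Matching surface: the timelike hypersurface $\Sigma_*$ given by $\chi=\chi_*$ in interior coordinates and by $t=t_*(\tau)$, $r=r_*(\tau)$ (smooth, $\dot t_*>0$) in exterior coordinates $(t,r,\theta,\varphi)$, with intrinsic coordinates $(\tau,\theta,\varphi)$. Smooth matching: for a quantity $Q$, $[Q]$ is the difference of its values on $\Sigma_*$ computed from the exterior and from the interior. The interior and exterior are smoothly matched in non-linear metric $f(R)$ gravity if all four junction conditions hold along $\Sigma_*$: $[h_{ab}]=0$ (induced metric), $[K_{ab}]=0$ (extrinsic curvature), $[R]=0$, and $[n^\mu\partial_\mu R]=0$, where $n$ is the unit normal to $\Sigma_*$. *)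

theory Defs
  imports "HOL-Analysis.Analysis"
begin

section \<open>Smooth functions of one real variable\<close>

text \<open>
  Smoothness on a set that need not be open (such as \<open>[0, \<tau>\<^sub>c)\<close>) means smoothness on some open
  neighbourhood of it. Hence \<^const>\<open>deriv\<close> is meaningful at the end points, where it agrees with
  the one-sided derivative.
\<close>

definition smooth_on :: "real set \<Rightarrow> (real \<Rightarrow> real) \<Rightarrow> bool" where
  "smooth_on S f \<longleftrightarrow>
     (\<exists>T. open T \<and> S \<subseteq> T \<and> (\<forall>n. \<forall>x\<in>T. (deriv ^^ n) f differentiable (at x)))"


section \<open>Pseudo-Riemannian geometry in one coordinate chart\<close>

text \<open>
  A point is its tuple of coordinates, and a metric (more generally a covariant 2-tensor field) is
  a map from points to component matrices.
\<close>

type_synonym 'n tensor2 = "real ^ 'n \<Rightarrow> real ^ 'n ^ 'n"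

definition pd :: "'n::finite \<Rightarrow> (real ^ 'n \<Rightarrow> real) \<Rightarrow> real ^ 'n \<Rightarrow> real" where
  "pd i F x = deriv (\<lambda>s. F (x + s *\<^sub>R axis i 1)) 0"

definition ginv :: "'n::finite tensor2 \<Rightarrow> 'n tensor2" where
  "ginv g x = matrix_inv (g x)"

text \<open>\<open>christoffel g \<rho> \<mu> \<nu>\<close> is \<open>\<Gamma>\<^sup>\<rho>\<close> with lower indices \<open>\<mu>\<close>, \<open>\<nu>\<close>.\<close>

definition christoffel :: "'n::finite tensor2 \<Rightarrow> 'n \<Rightarrow> 'n \<Rightarrow> 'n \<Rightarrow> real ^ 'n \<Rightarrow> real" where
  "christoffel g \<rho> \<mu> \<nu> x =
     (1/2) * (\<Sum>\<sigma>\<in>UNIV. ginv g x $ \<rho> $ \<sigma> *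
        (pd \<mu> (\<lambda>y. g y $ \<sigma> $ \<nu>) x + pd \<nu> (\<lambda>y. g y $ \<sigma> $ \<mu>) x - pd \<sigma> (\<lambda>y. g y $ \<mu> $ \<nu>) x))"

text \<open>
  \<open>riemann g \<rho> \<sigma> \<mu> \<nu>\<close> has the first index up. In this sign convention, with signature
  \<open>(+,-,-,-)\<close>, the Ricci scalar of a Robertson--Walker metric is
  \<open>6 ((a'\<^sup>2 + k) / a\<^sup>2 + a'' / a)\<close>.
\<close>

definition riemann ::
  "'n::finite tensor2 \<Rightarrow> 'n \<Rightarrow> 'n \<Rightarrow> 'n \<Rightarrow> 'n \<Rightarrow> real ^ 'n \<Rightarrow> real" where
  "riemann g \<rho> \<sigma> \<mu> \<nu> x =
     (pd \<nu> (christoffel g \<rho> \<sigma> \<mu>) x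
        + (\<Sum>l\<in>UNIV. christoffel g \<rho> l \<nu> x * christoffel g l \<sigma> \<mu> x))
   - (pd \<mu> (christoffel g \<rho> \<sigma> \<nu>) x
        + (\<Sum>l\<in>UNIV. christoffel g \<rho> l \<mu> x * christoffel g l \<sigma> \<nu> x))"

definition ricci :: "'n::finite tensor2 \<Rightarrow> 'n tensor2" where
  "ricci g x = (\<chi> \<mu> \<nu>. \<Sum>l\<in>UNIV. riemann g l \<mu> l \<nu> x)"

definition ricci_scalar :: "'n::finite tensor2 \<Rightarrow> real ^ 'n \<Rightarrow> real" where
  "ricci_scalar g x = (\<Sum>\<mu>\<in>UNIV. \<Sum>\<nu>\<in>UNIV. ginv g x $ \<mu> $ \<nu> * ricci g x $ \<mu> $ \<nu>)"

definition hessian :: "'n::finite tensor2 \<Rightarrow> (real ^ 'n \<Rightarrow> real) \<Rightarrow> 'n tensor2" where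
  "hessian g F x =
     (\<chi> \<mu> \<nu>. pd \<mu> (pd \<nu> F) x - (\<Sum>l\<in>UNIV. christoffel g l \<mu> \<nu> x * pd l F x))"

definition box :: "'n::finite tensor2 \<Rightarrow> (real ^ 'n \<Rightarrow> real) \<Rightarrow> real ^ 'n \<Rightarrow> real" where
  "box g F x = (\<Sum>\<mu>\<in>UNIV. \<Sum>\<nu>\<in>UNIV. ginv g x $ \<mu> $ \<nu> * hessian g F x $ \<mu> $ \<nu>)"


section \<open>Metric \<open>f(R)\<close> gravity\<close>

definition nonlinear_fR_model :: "real set \<Rightarrow> (real \<Rightarrow> real) \<Rightarrow> bool" where
  "nonlinear_fR_model J f \<longleftrightarrow>
     is_interval J \<and> smooth_on J f \<and> (\<forall>R\<in>J. deriv (deriv f) R \<noteq> 0)"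

definition fR_equations ::
  "real \<Rightarrow> (real \<Rightarrow> real) \<Rightarrow> 'n::finite tensor2 \<Rightarrow> 'n tensor2 \<Rightarrow> real ^ 'n \<Rightarrow> bool" where
  "fR_equations \<kappa> f g T x \<longleftrightarrow>
     (let F = (\<lambda>y. deriv f (ricci_scalar g y)) in
      \<forall>\<mu> \<nu>. F x * ricci g x $ \<mu> $ \<nu> - (1/2) * f (ricci_scalar g x) * g x $ \<mu> $ \<nu>
             + (hessian g F x $ \<mu> $ \<nu> - g x $ \<mu> $ \<nu> * box g F x)
           = - \<kappa> * T x $ \<mu> $ \<nu>)"

text \<open>The field equations on a region \<open>D\<close> presuppose that \<open>R\<close> takes its values there in the domain
  \<open>J\<close> of \<open>f\<close>.\<close>

definition solves_fR ::
  "real \<Rightarrow> real set \<Rightarrow> (real \<Rightarrow> real) \<Rightarrow> 'n::finite tensor2 \<Rightarrow> 'n tensor2 \<Rightarrow> (real ^ 'n) set \<Rightarrow> bool"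
where
  "solves_fR \<kappa> J f g T D \<longleftrightarrow> (\<forall>x\<in>D. ricci_scalar g x \<in> J \<and> fR_equations \<kappa> f g T x)"

definition dust_tensor ::
  "'n::finite tensor2 \<Rightarrow> (real ^ 'n \<Rightarrow> real) \<Rightarrow> (real ^ 'n \<Rightarrow> real ^ 'n) \<Rightarrow> 'n tensor2" where
  "dust_tensor g \<rho> u x = (\<chi> \<mu> \<nu>. \<rho> x * (g x *v u x) $ \<mu> * (g x *v u x) $ \<nu>)"


section \<open>Hypersurfaces and junction conditions\<close>

text \<open>
  A hypersurface is given by its embedding \<open>\<Phi>\<close> from intrinsic coordinates \<open>(\<tau>, \<theta>, \<phi>)\<close> into a chart
  whose second coordinate is the radial one. \<open>tangent \<Phi> a y\<close> is the coordinate tangent vector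
  \<open>e\<^sub>a\<close>.
\<close>

definition tangent :: "(real ^ 3 \<Rightarrow> real ^ 4) \<Rightarrow> 3 \<Rightarrow> real ^ 3 \<Rightarrow> real ^ 4" where
  "tangent \<Phi> a y = (\<chi> \<mu>. pd a (\<lambda>z. \<Phi> z $ \<mu>) y)"

definition metric_product :: "4 tensor2 \<Rightarrow> real ^ 4 \<Rightarrow> real ^ 4 \<Rightarrow> real ^ 4 \<Rightarrow> real" where
  "metric_product g x v w = (\<Sum>\<mu>\<in>UNIV. \<Sum>\<nu>\<in>UNIV. g x $ \<mu> $ \<nu> * v $ \<mu> * w $ \<nu>)"

definition induced_metric ::
  "4 tensor2 \<Rightarrow> (real ^ 3 \<Rightarrow> real ^ 4) \<Rightarrow> 3 \<Rightarrow> 3 \<Rightarrow> real ^ 3 \<Rightarrow> real" where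
  "induced_metric g \<Phi> a b y = metric_product g (\<Phi> y) (tangent \<Phi> a y) (tangent \<Phi> b y)"

text \<open>
  The normal of a timelike hypersurface is spacelike, so its square is \<open>-1\<close> in signature
  \<open>(+,-,-,-)\<close>. It is oriented towards increasing radial coordinate, that is, from the interior
  to the exterior on both sides of the matching surface.
\<close>

definition unit_normal :: "4 tensor2 \<Rightarrow> (real ^ 3 \<Rightarrow> real ^ 4) \<Rightarrow> real ^ 3 \<Rightarrow> real ^ 4" where
  "unit_normal g \<Phi> y =
     (THE n. (\<forall>a. metric_product g (\<Phi> y) n (tangent \<Phi> a y) = 0) \<and>
             metric_product g (\<Phi> y) n n = -1 \<and> n $ 2 > 0)"

definition unit_conormal :: "4 tensor2 \<Rightarrow> (real ^ 3 \<Rightarrow> real ^ 4) \<Rightarrow> real ^ 3 \<Rightarrow> real ^ 4" where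
  "unit_conormal g \<Phi> y = g (\<Phi> y) *v unit_normal g \<Phi> y"

text \<open>
  \<open>K\<^sub>a\<^sub>b = e\<^sub>a\<^sup>\<mu> e\<^sub>b\<^sup>\<nu> \<nabla>\<^sub>\<mu> n\<^sub>\<nu>\<close>. As \<open>n\<close> is only differentiated along the hypersurface, the term
  \<open>e\<^sub>a\<^sup>\<mu> \<partial>\<^sub>\<mu> n\<^sub>\<nu>\<close> is the derivative of \<open>n\<^sub>\<nu>\<close> with respect to the intrinsic coordinate \<open>a\<close>.
\<close>

definition extrinsic_curvature ::
  "4 tensor2 \<Rightarrow> (real ^ 3 \<Rightarrow> real ^ 4) \<Rightarrow> 3 \<Rightarrow> 3 \<Rightarrow> real ^ 3 \<Rightarrow> real" where
  "extrinsic_curvature g \<Phi> a b y =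
     (\<Sum>\<nu>\<in>UNIV. tangent \<Phi> b y $ \<nu> *
        (pd a (\<lambda>z. unit_conormal g \<Phi> z $ \<nu>) y
         - (\<Sum>\<mu>\<in>UNIV. \<Sum>l\<in>UNIV.
              christoffel g l \<mu> \<nu> (\<Phi> y) * tangent \<Phi> a y $ \<mu> * unit_conormal g \<Phi> y $ l)))"

definition normal_derivative ::
  "4 tensor2 \<Rightarrow> (real ^ 3 \<Rightarrow> real ^ 4) \<Rightarrow> (real ^ 4 \<Rightarrow> real) \<Rightarrow> real ^ 3 \<Rightarrow> real" where
  "normal_derivative g \<Phi> F y = (\<Sum>\<mu>\<in>UNIV. unit_normal g \<Phi> y $ \<mu> * pd \<mu> F (\<Phi> y))"

text \<open>The two embeddings \<open>\<Phi>p\<close>, \<open>\<Phi>m\<close> (exterior, interior) of the matching surface use the same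
  intrinsic coordinates, which range over \<open>S\<close>.\<close>

definition smoothly_matched_fR ::
  "(real ^ 3) set \<Rightarrow> 4 tensor2 \<Rightarrow> (real ^ 3 \<Rightarrow> real ^ 4) \<Rightarrow> 4 tensor2 \<Rightarrow> (real ^ 3 \<Rightarrow> real ^ 4) \<Rightarrow> bool"
where
  "smoothly_matched_fR S gp \<Phi>p gm \<Phi>m \<longleftrightarrow>
     (\<forall>y\<in>S.
        (\<forall>a b. induced_metric gp \<Phi>p a b y = induced_metric gm \<Phi>m a b y) \<and>
        (\<forall>a b. extrinsic_curvature gp \<Phi>p a b y = extrinsic_curvature gm \<Phi>m a b y) \<and>
        ricci_scalar gp (\<Phi>p y) = ricci_scalar gm (\<Phi>m y) \<and>
        normal_derivative gp \<Phi>p (ricci_scalar gp) y =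
          normal_derivative gm \<Phi>m (ricci_scalar gm) y)"


section \<open>The collapsing uniform-density dust star\<close>

definition diag4 :: "real \<Rightarrow> real \<Rightarrow> real \<Rightarrow> real \<Rightarrow> real ^ 4 ^ 4" where
  "diag4 p q r s =
     (\<chi> i j. if i \<noteq> j then 0 else if i = 1 then p else if i = 2 then q else if i = 3 then r else s)"

definition vec4 :: "real \<Rightarrow> real \<Rightarrow> real \<Rightarrow> real \<Rightarrow> real ^ 4" where
  "vec4 p q r s = (\<chi> i. if i = 1 then p else if i = 2 then q else if i = 3 then r else s)"

text \<open>Interior coordinates are \<open>(\<tau>, \<chi>, \<theta>, \<phi>)\<close>.\<close>

definition interior_metric :: "real \<Rightarrow> (real \<Rightarrow> real) \<Rightarrow> 4 tensor2" where
  "interior_metric k a x =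
     diag4 1 (- (a (x$1))\<^sup>2 / (1 - k * (x$2)\<^sup>2))
             (- (a (x$1))\<^sup>2 * (x$2)\<^sup>2)
             (- (a (x$1))\<^sup>2 * (x$2)\<^sup>2 * (sin (x$3))\<^sup>2)"

text \<open>The centre \<open>\<chi> = 0\<close> and the axis \<open>\<theta> \<in> {0, \<pi>}\<close> are singularities of the coordinates.\<close>

definition interior_region :: "real \<Rightarrow> real \<Rightarrow> (real ^ 4) set" where
  "interior_region \<chi>s \<tau>c =
     {x. 0 \<le> x$1 \<and> x$1 < \<tau>c \<and> 0 < x$2 \<and> x$2 \<le> \<chi>s \<and> 0 < x$3 \<and> x$3 < pi}"

definition collapsing_dust_star ::
  "real \<Rightarrow> real set \<Rightarrow> (real \<Rightarrow> real) \<Rightarrow> real \<Rightarrow> real \<Rightarrow> real \<Rightarrow> real \<Rightarrow> (real \<Rightarrow> real) \<Rightarrow> bool"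
where
  "collapsing_dust_star \<kappa> J f k \<rho>0 \<chi>s \<tau>c a \<longleftrightarrow>
     \<rho>0 > 0 \<and> \<chi>s > 0 \<and> 1 - k * \<chi>s\<^sup>2 > 0 \<and> \<tau>c > 0 \<and>
     smooth_on {0..<\<tau>c} a \<and> (\<forall>\<tau>\<in>{0..<\<tau>c}. a \<tau> > 0) \<and>
     a 0 = 1 \<and> deriv a 0 = 0 \<and> (\<forall>\<tau>\<in>{0<..<\<tau>c}. deriv a \<tau> < 0) \<and>
     solves_fR \<kappa> J f (interior_metric k a)
       (dust_tensor (interior_metric k a) (\<lambda>x. \<rho>0 / (a (x$1)) ^ 3) (\<lambda>x. axis 1 1))
       (interior_region \<chi>s \<tau>c)"


section \<open>The exterior and the matching surface\<close>

text \<open>Exterior coordinates are \<open>(t, r, \<theta>, \<phi>)\<close>.\<close>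

definition exterior_metric :: "(real \<Rightarrow> real) \<Rightarrow> (real \<Rightarrow> real) \<Rightarrow> 4 tensor2" where
  "exterior_metric U V x =
     diag4 (U (x$2)) (- V (x$1) / U (x$2)) (- (x$2)\<^sup>2) (- (x$2)\<^sup>2 * (sin (x$3))\<^sup>2)"

text \<open>The part of the chart that lies outside the star, including its surface.\<close>

definition exterior_region ::
  "real set \<Rightarrow> real \<Rightarrow> (real \<Rightarrow> real) \<Rightarrow> (real \<Rightarrow> real) \<Rightarrow> (real ^ 4) set" where
  "exterior_region Ir \<tau>c ts rs =
     {x. (\<exists>\<tau>\<in>{0..<\<tau>c}. x$1 = ts \<tau> \<and> rs \<tau> \<le> x$2) \<and> x$2 \<in> Ir \<and> 0 < x$3 \<and> x$3 < pi}"

text \<open>\<open>V\<close> and \<open>U\<close> live on intervals \<open>It\<close> and \<open>Ir\<close> of values of \<open>t\<close> and \<open>r\<close>; the surface of the star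
  is \<open>t = ts \<tau>\<close>, \<open>r = rs \<tau>\<close>.\<close>

definition vacuum_exterior ::
  "real \<Rightarrow> real set \<Rightarrow> (real \<Rightarrow> real) \<Rightarrow> real \<Rightarrow> real set \<Rightarrow> real set \<Rightarrow> (real \<Rightarrow> real) \<Rightarrow>
   (real \<Rightarrow> real) \<Rightarrow> (real \<Rightarrow> real) \<Rightarrow> (real \<Rightarrow> real) \<Rightarrow> bool" where
  "vacuum_exterior \<kappa> J f \<tau>c It Ir U V ts rs \<longleftrightarrow>
     is_interval It \<and> is_interval Ir \<and> Ir \<subseteq> {0<..} \<and>
     smooth_on Ir U \<and> (\<forall>r\<in>Ir. U r > 0) \<and> smooth_on It V \<and> (\<forall>t\<in>It. V t > 0) \<and>
     smooth_on {0..<\<tau>c} ts \<and> smooth_on {0..<\<tau>c} rs \<and> (\<forall>\<tau>\<in>{0..<\<tau>c}. deriv ts \<tau> > 0) \<and>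
     ts ` {0..<\<tau>c} \<subseteq> It \<and> rs ` {0..<\<tau>c} \<subseteq> Ir \<and>
     solves_fR \<kappa> J f (exterior_metric U V) (\<lambda>x. 0) (exterior_region Ir \<tau>c ts rs)"

definition surface_domain :: "real \<Rightarrow> (real ^ 3) set" where
  "surface_domain \<tau>c = {y. 0 \<le> y$1 \<and> y$1 < \<tau>c \<and> 0 < y$2 \<and> y$2 < pi}"

definition interior_embedding :: "real \<Rightarrow> real ^ 3 \<Rightarrow> real ^ 4" where
  "interior_embedding \<chi>s y = vec4 (y$1) \<chi>s (y$2) (y$3)"

definition exterior_embedding :: "(real \<Rightarrow> real) \<Rightarrow> (real \<Rightarrow> real) \<Rightarrow> real ^ 3 \<Rightarrow> real ^ 4" where
  "exterior_embedding ts rs y = vec4 (ts (y$1)) (rs (y$1)) (y$2) (y$3)"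

end

theory Submission
  imports Defs
begin

text \<open>
  The matching conditions for the induced metric and for \<open>K\<^sub>\<theta>\<^sub>\<theta>\<close> give \<open>r\<^sub>* = a \<chi>\<^sub>*\<close> and
  \<open>U t\<^sub>*' = \<beta> \<surd>V\<close> with a constant \<open>\<beta> > 0\<close>. Since the surface consists of dust geodesics, \<open>K\<^sub>\<tau>\<^sub>\<tau>\<close>
  vanishes, so the exterior curve \<open>(t\<^sub>*, r\<^sub>*)\<close> is a geodesic; comparing its \<open>t\<close>-equation with the
  derivative of \<open>U t\<^sub>*' = \<beta> \<surd>V\<close> forces \<open>V' = 0\<close> along it. The exterior is then static near the
  surface, so \<open>R\<^sup>+\<close> depends on \<open>r\<close> only. As \<open>R\<^sup>-\<close> is homogeneous, its normal derivative vanishes,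
  and hence \<open>R\<^sup>+\<close> is constant on the interval swept by \<open>r\<^sub>*\<close>, and \<open>R\<^sup>-\<close> is the same constant.
  For constant \<open>R\<close> the trace of the field equations is \<open>f\<^sub>R R - 2 f = - \<kappa> T\<close>, whose right hand side
  is \<open>0\<close> outside and \<open>- \<kappa> \<rho>\<^sub>0 / a\<^sup>3\<close> inside.
\<close>

section \<open>Partial derivatives in a chart\<close>

lemma axis_nth: "axis i (1::real) $ j = (if j = i then 1 else 0)"
  by (simp add: axis_def)

text \<open>A partial derivative sees only the germ of a function at the point. Hence closed forms
  for Christoffel symbols and Ricci scalars that are valid on an open set only may be differentiated
  there.\<close>

lemma pd_cong:
  assumes "open D" "x \<in> D" "\<And>y. y \<in> D \<Longrightarrow> F y = G y"
  shows "pd i F x = pd i G x"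
proof -
  have "open ((\<lambda>s. x + s *\<^sub>R axis i 1) -` D)"
    by (intro open_vimage assms(1) continuous_intros)
  then have "\<forall>\<^sub>F s in nhds 0. s \<in> (\<lambda>s. x + s *\<^sub>R axis i 1) -` D"
    by (rule eventually_nhds_in_open) (simp add: assms(2))
  then have "\<forall>\<^sub>F s in nhds 0. F (x + s *\<^sub>R axis i 1) = G (x + s *\<^sub>R axis i 1)"
    by (rule eventually_mono) (auto simp: assms(3))
  then show ?thesis
    unfolding pd_def by (rule deriv_cong_ev) simp
qed

lemma pd_const [simp]: "pd i (\<lambda>y. c) x = 0"
  by (simp add: pd_def)

lemma pd_locally_const:
  assumes "open D" "x \<in> D" "\<And>y. y \<in> D \<Longrightarrow> F y = c"
  shows "pd i F x = 0"
  using pd_cong[OF assms(1,2), of F "\<lambda>_. c"] assms(3) by simp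

lemma pd_eq_deriv:
  assumes "(\<phi> has_real_derivative d) (at (x $ i))"
    and "\<And>s. F (x + s *\<^sub>R axis i 1) = \<phi> (x $ i + s)"
  shows "pd i F x = d"
proof -
  have "((\<lambda>s. \<phi> (x $ i + s)) has_real_derivative d) (at 0)"
    using assms(1) DERIV_shift[of \<phi> d 0 "x $ i"] by (simp add: add.commute)
  then show ?thesis
    unfolding pd_def assms(2) by (rule DERIV_imp_deriv)
qed

text \<open>Metrics and curvatures below do not depend on the azimuth, so every function to be
  differentiated has the shape \<open>h (y $ 1) (y $ 2) (y $ 3)\<close>; freezing two arguments
  leaves an ordinary derivative.\<close>

lemma pd_1:
  fixes x :: "real ^ 4"
  assumes "((\<lambda>t. h t (x $ 2) (x $ 3)) has_real_derivative d) (at (x $ 1))"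
  shows "pd 1 (\<lambda>y. h (y $ 1) (y $ 2) (y $ 3)) x = d"
  by (rule pd_eq_deriv[OF assms]) (simp add: axis_nth)

lemma pd_2:
  fixes x :: "real ^ 4"
  assumes "((\<lambda>r. h (x $ 1) r (x $ 3)) has_real_derivative d) (at (x $ 2))"
  shows "pd 2 (\<lambda>y. h (y $ 1) (y $ 2) (y $ 3)) x = d"
  by (rule pd_eq_deriv[OF assms]) (simp add: axis_nth)

lemma pd_3:
  fixes x :: "real ^ 4"
  assumes "((\<lambda>\<theta>. h (x $ 1) (x $ 2) \<theta>) has_real_derivative d) (at (x $ 3))"
  shows "pd 3 (\<lambda>y. h (y $ 1) (y $ 2) (y $ 3)) x = d"
  by (rule pd_eq_deriv[OF assms]) (simp add: axis_nth)

lemma pd_4: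
  fixes x :: "real ^ 4"
  shows "pd 4 (\<lambda>y. h (y $ 1) (y $ 2) (y $ 3)) x = 0"
  by (rule pd_eq_deriv[of "\<lambda>_. h (x $ 1) (x $ 2) (x $ 3)"]) (auto simp: axis_nth)

section \<open>Diagonal matrices and coordinate vectors\<close>

lemma diag4_nth:
  "diag4 p q r s $ i $ j =
     (if i \<noteq> j then 0 else if i = 1 then p else if i = 2 then q else if i = 3 then r else s)"
  by (simp add: diag4_def)

lemma vec4_nth:
  "vec4 p q r s $ i = (if i = 1 then p else if i = 2 then q else if i = 3 then r else s)"
  by (simp add: vec4_def)

lemma matrix_inv_diag4:
  assumes "p \<noteq> 0" "q \<noteq> 0" "r \<noteq> 0" "s \<noteq> 0"
  shows "matrix_inv (diag4 p q r s) = diag4 (1/p) (1/q) (1/r) (1/s)"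
proof -
  let ?M = "diag4 p q r s" and ?N = "diag4 (1/p) (1/q) (1/r) (1/s)"
  have 1: "?M ** ?N = mat 1" "?N ** ?M = mat 1"
    using assms
    by (simp_all add: vec_eq_iff matrix_matrix_mult_def mat_def forall_4 sum_4 diag4_nth)
  \<comment> \<open>\<open>matrix_inv\<close> chooses some two-sided inverse; uniqueness pins it
    down.\<close>
  have "N = ?N" if "?M ** N = mat 1" for N
  proof -
    have "N = (?N ** ?M) ** N"
      by (simp add: 1)
    also have "\<dots> = ?N"
      by (simp add: that flip: matrix_mul_assoc)
    finally show ?thesis .
  qed
  then show ?thesis
    unfolding matrix_inv_def using 1 by (intro some_equality conjI) (assumption | elim conjE)+
qed

section \<open>Curvature of spherically symmetric metrics with separated coefficients\<close>

text \<open>One family for both sides of the junction; capitals depend on the radius, small letters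
  on time. The interior has \<open>A = 1\<close>, \<open>B = 1 / (1 - k r^2)\<close>,
  \<open>C = r^2\<close>, \<open>b = c = a^2\<close>; the exterior has \<open>A = U\<close>,
  \<open>B = 1 / U\<close>, \<open>C = r^2\<close>, \<open>b = V\<close>,
  \<open>c = 1\<close>.\<close>

definition sep_metric ::
  "(real \<Rightarrow> real) \<Rightarrow> (real \<Rightarrow> real) \<Rightarrow> (real \<Rightarrow> real) \<Rightarrow> (real \<Rightarrow> real) \<Rightarrow> (real \<Rightarrow> real) \<Rightarrow> 4 tensor2" where
  "sep_metric A B C b c x =
     diag4 (A (x$2)) (- (b (x$1) * B (x$2))) (- (c (x$1) * C (x$2)))
       (- (c (x$1) * C (x$2) * (sin (x$3))\<^sup>2))"

text \<open>The derivatives are parameters, so that each instance can supply closed forms. They are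
  given up to the order in which they enter the Ricci tensor.\<close>

locale separable_metric =
  fixes S T :: "real set" and A A1 A2 B B1 C C1 C2 b b1 b2 c c1 c2 :: "real \<Rightarrow> real"
  assumes open_S: "open S" and open_T: "open T"
    and A: "r \<in> S \<Longrightarrow> (A has_real_derivative A1 r) (at r)"
    and A1: "r \<in> S \<Longrightarrow> (A1 has_real_derivative A2 r) (at r)"
    and B: "r \<in> S \<Longrightarrow> (B has_real_derivative B1 r) (at r)"
    and C: "r \<in> S \<Longrightarrow> (C has_real_derivative C1 r) (at r)"
    and C1: "r \<in> S \<Longrightarrow> (C1 has_real_derivative C2 r) (at r)"
    and b: "t \<in> T \<Longrightarrow> (b has_real_derivative b1 t) (at t)"
    and b1: "t \<in> T \<Longrightarrow> (b1 has_real_derivative b2 t) (at t)"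
    and c: "t \<in> T \<Longrightarrow> (c has_real_derivative c1 t) (at t)"
    and c1: "t \<in> T \<Longrightarrow> (c1 has_real_derivative c2 t) (at t)"
    and pos_S: "r \<in> S \<Longrightarrow> A r > 0" "r \<in> S \<Longrightarrow> B r > 0" "r \<in> S \<Longrightarrow> C r > 0"
    and pos_T: "t \<in> T \<Longrightarrow> b t > 0" "t \<in> T \<Longrightarrow> c t > 0"
begin

abbreviation g :: "4 tensor2" where "g \<equiv> sep_metric A B C b c"

text \<open>Leaving out the axis keeps \<open>sin \<theta>\<close> positive, so the metric is
  invertible on all of this open set.\<close>

definition chart :: "(real ^ 4) set" where
  "chart = {x. x$1 \<in> T \<and> x$2 \<in> S \<and> 0 < x$3 \<and> x$3 < pi}"

lemma open_chart: "open chart"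
proof -
  have "chart = (\<lambda>x. x$1) -` T \<inter> (\<lambda>x. x$2) -` S \<inter> (\<lambda>x. x$3) -` {0<..<pi}"
    by (auto simp: chart_def)
  also have "open \<dots>"
    by (intro open_Int open_vimage open_S open_T open_greaterThanLessThan continuous_intros)
  finally show ?thesis .
qed

lemma chartD:
  assumes "x \<in> chart"
  shows "x$1 \<in> T" "x$2 \<in> S" "sin (x$3) > 0"
    "A (x$2) > 0" "B (x$2) > 0" "C (x$2) > 0" "b (x$1) > 0" "c (x$1) > 0"
  using assms pos_S pos_T by (auto simp: chart_def sin_gt_zero)

section \<open>Inverse metric and Christoffel symbols\<close>

lemma ginv_g:
  assumes "x \<in> chart"
  shows "ginv g x = diag4 (1 / A (x$2)) (- 1 / (b (x$1) * B (x$2))) (- 1 / (c (x$1) * C (x$2)))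
       (- 1 / (c (x$1) * C (x$2) * (sin (x$3))\<^sup>2))"
  using chartD[OF assms] by (simp add: ginv_def sep_metric_def matrix_inv_diag4)

definition dmetric :: "4 \<Rightarrow> 4 \<Rightarrow> 4 \<Rightarrow> real \<Rightarrow> real \<Rightarrow> real \<Rightarrow> real" where
  "dmetric l i j t r \<theta> =
     (if i \<noteq> j then 0
      else if i = 1 then (if l = 2 then A1 r else 0)
      else if i = 2 then (if l = 1 then - (b1 t * B r) else if l = 2 then - (b t * B1 r) else 0)
      else if i = 3 then (if l = 1 then - (c1 t * C r) else if l = 2 then - (c t * C1 r) else 0)
      else (if l = 1 then - (c1 t * C r * (sin \<theta>)\<^sup>2) else if l = 2 then - (c t * C1 r * (sin \<theta>)\<^sup>2)
            else if l = 3 then - (2 * c t * C r * sin \<theta> * cos \<theta>) else 0))"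

lemma pd_metric:
  assumes "x \<in> chart"
  shows "pd l (\<lambda>y. g y $ i $ j) x = dmetric l i j (x$1) (x$2) (x$3)"
proof -
  note [derivative_intros] =
    A[OF chartD(2)[OF assms]] B[OF chartD(2)[OF assms]] C[OF chartD(2)[OF assms]]
    b[OF chartD(1)[OF assms]] c[OF chartD(1)[OF assms]]
  have "\<forall>l i j. pd l (\<lambda>y. g y $ i $ j) x = dmetric l i j (x$1) (x$2) (x$3)"
    unfolding forall_4 sep_metric_def dmetric_def
    by (simp add: diag4_nth)
      (intro conjI; (rule pd_1 pd_2 pd_3 pd_4); auto intro!: derivative_eq_intros)
  then show ?thesis by blast
qed

text \<open>A function of three real arguments instead of a point, so that \<open>pd_1\<close> to
  \<open>pd_4\<close> give the derivatives that the Riemann tensor asks for.\<close>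

definition christoffel_table :: "4 \<Rightarrow> 4 \<Rightarrow> 4 \<Rightarrow> real \<Rightarrow> real \<Rightarrow> real \<Rightarrow> real" where
  "christoffel_table l i j t r \<theta> =
     (if l = 1 then
        (if i = 1 \<and> j = 2 \<or> i = 2 \<and> j = 1 then A1 r / (2 * A r)
         else if i = 2 \<and> j = 2 then b1 t * B r / (2 * A r)
         else if i = 3 \<and> j = 3 then c1 t * C r / (2 * A r)
         else if i = 4 \<and> j = 4 then c1 t * C r * (sin \<theta>)\<^sup>2 / (2 * A r)
         else 0)
      else if l = 2 then
        (if i = 1 \<and> j = 1 then A1 r / (2 * b t * B r)
         else if i = 1 \<and> j = 2 \<or> i = 2 \<and> j = 1 then b1 t / (2 * b t)
         else if i = 2 \<and> j = 2 then B1 r / (2 * B r)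
         else if i = 3 \<and> j = 3 then - (c t * C1 r / (2 * b t * B r))
         else if i = 4 \<and> j = 4 then - (c t * C1 r * (sin \<theta>)\<^sup>2 / (2 * b t * B r))
         else 0)
      else if l = 3 then
        (if i = 1 \<and> j = 3 \<or> i = 3 \<and> j = 1 then c1 t / (2 * c t)
         else if i = 2 \<and> j = 3 \<or> i = 3 \<and> j = 2 then C1 r / (2 * C r)
         else if i = 4 \<and> j = 4 then - (sin \<theta> * cos \<theta>)
         else 0)
      else
        (if i = 1 \<and> j = 4 \<or> i = 4 \<and> j = 1 then c1 t / (2 * c t)
         else if i = 2 \<and> j = 4 \<or> i = 4 \<and> j = 2 then C1 r / (2 * C r)
         else if i = 3 \<and> j = 4 \<or> i = 4 \<and> j = 3 then cos \<theta> / sin \<theta>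
         else 0))"

lemma christoffel_g:
  assumes "x \<in> chart"
  shows "christoffel g l i j x = christoffel_table l i j (x$1) (x$2) (x$3)"
proof -
  have "\<forall>l i j. christoffel g l i j x = christoffel_table l i j (x$1) (x$2) (x$3)"
    unfolding christoffel_def pd_metric[OF assms] ginv_g[OF assms] sum_4
    using chartD[OF assms]
    by (simp add: forall_4 diag4_nth dmetric_def christoffel_table_def) (simp add: power2_eq_square)
  then show ?thesis by blast
qed

lemma pd_christoffel_g:
  assumes "x \<in> chart"
  shows "pd m (christoffel g l i j) x = pd m (\<lambda>y. christoffel_table l i j (y$1) (y$2) (y$3)) x"
  by (rule pd_cong[OF open_chart assms christoffel_g])

section \<open>Diagonal Ricci components and the Ricci scalar\<close>

lemma ricci_1_1:
  assumes "x \<in> chart"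
  defines "t \<equiv> x$1" and "r \<equiv> x$2"
  shows "ricci g x $ 1 $ 1 =
    b2 t / (2 * b t) - (b1 t / (2 * b t))\<^sup>2 + 2 * (c2 t / (2 * c t) - (c1 t / (2 * c t))\<^sup>2)
    - A2 r / (2 * b t * B r)
    + A1 r / (2 * b t * B r) * (A1 r / (2 * A r) + B1 r / (2 * B r) - C1 r / C r)"
proof -
  note D = chartD[OF assms(1), folded t_def r_def]
  note [derivative_intros] = A1[OF D(2)] B[OF D(2)] b[OF D(1)] c[OF D(1)] b1[OF D(1)] c1[OF D(1)]
  \<comment> \<open>The contraction over \<open>l\<close> contains the derivative of the symbol
    \<open>(l; 1 l)\<close> in direction 1 and that of \<open>(l; 1 1)\<close> in direction
    \<open>l\<close>. They cancel for \<open>l = 1\<close>; facts 1 to 4 evaluate them for the other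
    \<open>l\<close>. The remaining components follow the same pattern.\<close>
  have 1: "pd 1 (\<lambda>y. christoffel_table 2 1 2 (y$1) (y$2) (y$3)) x =
      (b2 t * b t - b1 t * b1 t) / (2 * (b t)\<^sup>2)"
    using D by (intro pd_1, simp only: christoffel_table_def t_def[symmetric])
       (auto intro!: derivative_eq_intros simp: field_simps power2_eq_square)
  have 2: "pd 1 (\<lambda>y. christoffel_table l 1 l (y$1) (y$2) (y$3)) x =
      (c2 t * c t - c1 t * c1 t) / (2 * (c t)\<^sup>2)"
    if "l = 3 \<or> l = 4" for l
    using D that by (intro pd_1, simp only: christoffel_table_def t_def[symmetric])
       (auto intro!: derivative_eq_intros simp: field_simps power2_eq_square)
  have 3: "pd 2 (\<lambda>y. christoffel_table 2 1 1 (y$1) (y$2) (y$3)) x =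
     (A2 r * B r - A1 r * B1 r) / (2 * b t * (B r)\<^sup>2)"
    using D by (intro pd_2, simp only: christoffel_table_def r_def[symmetric] t_def[symmetric])
       (auto intro!: derivative_eq_intros simp: field_simps power2_eq_square)
  have 4: "pd l (\<lambda>y. christoffel_table l 1 1 (y$1) (y$2) (y$3)) x = 0" if "l = 3 \<or> l = 4" for l
    using that by (auto simp: christoffel_table_def)
  show ?thesis
    using D
    apply (simp add: ricci_def riemann_def sum_4 pd_christoffel_g christoffel_g assms(1) 1 2 3 4)
    apply (simp add: christoffel_table_def)
    apply (simp add: field_simps power2_eq_square flip: t_def r_def)
    done
qed

lemma ricci_2_2:
  assumes "x \<in> chart"
  defines "t \<equiv> x$1" and "r \<equiv> x$2"
  shows "ricci g x $ 2 $ 2 =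
    A2 r / (2 * A r) - (A1 r / (2 * A r))\<^sup>2 - A1 r * B1 r / (4 * A r * B r)
    - b2 t * B r / (2 * A r) + b1 t * B r / (2 * A r) * (b1 t / (2 * b t) - c1 t / c t)
    + 2 * (C2 r / (2 * C r) - (C1 r / (2 * C r))\<^sup>2 - C1 r * B1 r / (4 * C r * B r))"
proof -
  note D = chartD[OF assms(1), folded t_def r_def]
  note [derivative_intros] = A1[OF D(2)] A[OF D(2)] b[OF D(1)] b1[OF D(1)]
    C[OF D(2)] C1[OF D(2)]
  have 1: "pd 2 (\<lambda>y. christoffel_table 1 2 1 (y$1) (y$2) (y$3)) x =
      (A2 r * A r - A1 r * A1 r) / (2 * (A r)\<^sup>2)"
    using D by (intro pd_2, simp only: christoffel_table_def r_def[symmetric])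
       (auto intro!: derivative_eq_intros simp: field_simps power2_eq_square)
  have 2: "pd 2 (\<lambda>y. christoffel_table l 2 l (y$1) (y$2) (y$3)) x =
      (C2 r * C r - C1 r * C1 r) / (2 * (C r)\<^sup>2)"
    if "l = 3 \<or> l = 4" for l
    using D that by (intro pd_2, simp only: christoffel_table_def r_def[symmetric])
       (auto intro!: derivative_eq_intros simp: field_simps power2_eq_square)
  have 3: "pd 1 (\<lambda>y. christoffel_table 1 2 2 (y$1) (y$2) (y$3)) x = b2 t * B r / (2 * A r)"
    using D by (intro pd_1, simp only: christoffel_table_def r_def[symmetric] t_def[symmetric])
       (auto intro!: derivative_eq_intros simp: field_simps power2_eq_square)
  have 4: "pd l (\<lambda>y. christoffel_table l 2 2 (y$1) (y$2) (y$3)) x = 0" if "l = 3 \<or> l = 4" for l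
    using that by (auto simp: christoffel_table_def)
  show ?thesis
    using D
    apply (simp add: ricci_def riemann_def sum_4 pd_christoffel_g christoffel_g assms(1) 1 2 3 4)
    apply (simp add: christoffel_table_def)
    apply (simp add: field_simps power2_eq_square flip: t_def r_def)
    done
qed

text \<open>The angular part of the Ricci tensor, common to both angles up to the factor
  \<open>sin^2 \<theta>\<close>. The summand \<open>- 1\<close> is the curvature of the unit sphere
  in this sign convention.\<close>

definition ricci_sphere :: "real \<Rightarrow> real \<Rightarrow> real" where
  "ricci_sphere t r =
     - 1 - c2 t * C r / (2 * A r) - b1 t * c1 t * C r / (4 * b t * A r)
     + c t * C1 r / (2 * b t * B r) * (A1 r / (2 * A r) - B1 r / (2 * B r))
     + c t * C2 r / (2 * b t * B r)"

lemma ricci_3_3: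
  assumes "x \<in> chart"
  shows "ricci g x $ 3 $ 3 = ricci_sphere (x$1) (x$2)"
proof -
  define t r \<theta> where "t = x$1" and "r = x$2" and "\<theta> = x$3"
  note D = chartD[OF assms(1), folded t_def r_def \<theta>_def]
  note [derivative_intros] = A1[OF D(2)] A[OF D(2)] B[OF D(2)] b[OF D(1)] b1[OF D(1)]
    C[OF D(2)] C1[OF D(2)] c1[OF D(1)]
  have sc: "cos \<theta> * cos \<theta> = 1 - sin \<theta> * sin \<theta>"
    using sin_cos_squared_add[of \<theta>] by (simp add: power2_eq_square)
  have 1: "pd 1 (\<lambda>y. christoffel_table 1 3 3 (y$1) (y$2) (y$3)) x = c2 t * C r / (2 * A r)"
    using D by (intro pd_1, simp only: christoffel_table_def r_def[symmetric] t_def[symmetric])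
       (auto intro!: derivative_eq_intros simp: field_simps power2_eq_square)
  have 2: "pd 2 (\<lambda>y. christoffel_table 2 3 3 (y$1) (y$2) (y$3)) x =
      - (c t * (C2 r * B r - C1 r * B1 r) / (2 * b t * (B r)\<^sup>2))"
    using D by (intro pd_2, simp only: christoffel_table_def r_def[symmetric] t_def[symmetric])
       (auto intro!: derivative_eq_intros simp: field_simps power2_eq_square)
  have 3: "pd 3 (\<lambda>y. christoffel_table l 3 l (y$1) (y$2) (y$3)) x = 0" if "l = 1 \<or> l = 2" for l
    using that by (auto simp: christoffel_table_def)
  have "((\<lambda>\<theta>. cos \<theta> / sin \<theta>) has_real_derivative - 1 / (sin \<theta>)\<^sup>2) (at \<theta>)"
    using DERIV_cot[of \<theta>] D by (simp add: cot_def[abs_def] field_simps)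
  then have 4: "pd 3 (\<lambda>y. christoffel_table 4 3 4 (y$1) (y$2) (y$3)) x = - 1 / (sin \<theta>)\<^sup>2"
    by (intro pd_3) (simp add: christoffel_table_def \<theta>_def)
  have 5: "pd 4 (\<lambda>y. christoffel_table 4 3 3 (y$1) (y$2) (y$3)) x = 0"
    by (simp add: christoffel_table_def)
  show ?thesis
    unfolding ricci_sphere_def
    using D
    apply (simp add: ricci_def riemann_def sum_4 pd_christoffel_g christoffel_g assms(1) 1 2 3 4 5)
    apply (simp add: christoffel_table_def flip: t_def r_def \<theta>_def)
    apply (simp add: field_simps power2_eq_square sc)
    done
qed

lemma ricci_4_4:
  assumes "x \<in> chart"
  shows "ricci g x $ 4 $ 4 = ricci_sphere (x$1) (x$2) * (sin (x$3))\<^sup>2"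
proof -
  define t r \<theta> where "t = x$1" and "r = x$2" and "\<theta> = x$3"
  note D = chartD[OF assms(1), folded t_def r_def \<theta>_def]
  note [derivative_intros] = A1[OF D(2)] A[OF D(2)] B[OF D(2)] b[OF D(1)] b1[OF D(1)]
    C[OF D(2)] C1[OF D(2)] c1[OF D(1)]
  have sc: "cos \<theta> * cos \<theta> = 1 - sin \<theta> * sin \<theta>"
    using sin_cos_squared_add[of \<theta>] by (simp add: power2_eq_square)
  have 1: "pd 1 (\<lambda>y. christoffel_table 1 4 4 (y$1) (y$2) (y$3)) x = c2 t * C r * (sin \<theta>)\<^sup>2 / (2 * A r)"
    using D by (intro pd_1, 
        simp only: christoffel_table_def r_def[symmetric] t_def[symmetric] \<theta>_def[symmetric])
       (auto intro!: derivative_eq_intros simp: field_simps power2_eq_square)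
  have 2: "pd 2 (\<lambda>y. christoffel_table 2 4 4 (y$1) (y$2) (y$3)) x =
      - (c t * (C2 r * B r - C1 r * B1 r) * (sin \<theta>)\<^sup>2 / (2 * b t * (B r)\<^sup>2))"
    using D by (intro pd_2, 
        simp only: christoffel_table_def r_def[symmetric] t_def[symmetric] \<theta>_def[symmetric])
       (auto intro!: derivative_eq_intros simp: field_simps power2_eq_square)
  have 3: "pd 3 (\<lambda>y. christoffel_table 3 4 4 (y$1) (y$2) (y$3)) x = (sin \<theta>)\<^sup>2 - (cos \<theta>)\<^sup>2"
    using D by (intro pd_3, simp only: christoffel_table_def \<theta>_def[symmetric])
       (auto intro!: derivative_eq_intros simp: field_simps power2_eq_square)
  have 4: "pd 4 (\<lambda>y. christoffel_table l i j (y$1) (y$2) (y$3)) x = 0" for l i j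
    by (rule pd_4)
  show ?thesis
    unfolding ricci_sphere_def
    using D
    apply (simp add: ricci_def riemann_def sum_4 pd_christoffel_g christoffel_g assms(1) 1 2 3 4)
    apply (simp add: christoffel_table_def flip: t_def r_def \<theta>_def)
    apply (simp add: field_simps power2_eq_square sc)
    done
qed

text \<open>The inverse metric is diagonal, and the two angular contributions agree because
  \<open>sin^2 \<theta>\<close> cancels; hence the factor 2.\<close>

lemma ricci_scalar_g:
  assumes "x \<in> chart"
  shows "ricci_scalar g x = ricci g x $ 1 $ 1 / A (x$2) - ricci g x $ 2 $ 2 / (b (x$1) * B (x$2))
    - 2 * ricci_sphere (x$1) (x$2) / (c (x$1) * C (x$2))"
proof -
  have s: "(sin (x$3))\<^sup>2 \<noteq> 0"
    using chartD(3)[OF assms] by simp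
  have "ricci_scalar g x = ricci g x $ 1 $ 1 / A (x$2) - ricci g x $ 2 $ 2 / (b (x$1) * B (x$2))
    - ricci g x $ 3 $ 3 / (c (x$1) * C (x$2))
    - ricci g x $ 4 $ 4 / (c (x$1) * C (x$2) * (sin (x$3))\<^sup>2)"
    by (simp add: ricci_scalar_def sum_4 ginv_g[OF assms] diag4_nth)
  also have "ricci g x $ 4 $ 4 / (c (x$1) * C (x$2) * (sin (x$3))\<^sup>2) =
      ricci_sphere (x$1) (x$2) / (c (x$1) * C (x$2))"
    unfolding ricci_4_4[OF assms] using s by (rule nonzero_mult_divide_mult_cancel_right)
  finally show ?thesis
    by (simp add: ricci_3_3[OF assms])
qed

section \<open>Trace of the field equations at constant curvature\<close>

lemma hessian_locally_const:
  assumes "open D" "x \<in> D" "\<And>y. y \<in> D \<Longrightarrow> F y = r"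
  shows "hessian g F x $ i $ j = 0"
proof -
  have "pd l F y = 0" if "y \<in> D" for l y
    by (rule pd_locally_const[OF assms(1) that assms(3)])
  then have "pd i (pd j F) x = 0" "pd l F x = 0" for l
    using assms(2) by (auto intro: pd_locally_const[OF assms(1,2)])
  then show ?thesis
    by (simp add: hessian_def)
qed

text \<open>If \<open>R\<close> is constant near \<open>x\<close>, so is \<open>deriv f R\<close>,
  and its Hessian and box vanish. What remains is algebraic and is contracted with the diagonal
  inverse metric.\<close>

lemma fR_trace_const_curvature:
  assumes x: "x \<in> chart" and D: "open D" "x \<in> D" "\<And>y. y \<in> D \<Longrightarrow> ricci_scalar g y = R"
    and eqs: "fR_equations \<kappa> f g E x"
  shows "deriv f R * R - 2 * f R = - \<kappa> * (\<Sum>\<mu>\<in>UNIV. ginv g x $ \<mu> $ \<mu> * E x $ \<mu> $ \<mu>)"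
proof -
  have R: "ricci_scalar g x = R"
    using D by blast
  have hess: "hessian g (\<lambda>y. deriv f (ricci_scalar g y)) x $ \<mu> $ \<nu> = 0" for \<mu> \<nu>
    by (rule hessian_locally_const[OF D(1,2)]) (simp add: D(3))
  have eq: "ginv g x $ \<mu> $ \<mu> * (deriv f R * ricci g x $ \<mu> $ \<mu> - 1/2 * f R * g x $ \<mu> $ \<mu>) =
      ginv g x $ \<mu> $ \<mu> * (- \<kappa> * E x $ \<mu> $ \<mu>)" for \<mu>
    using eqs by (simp add: fR_equations_def Let_def box_def hess R)
  \<comment> \<open>Summed over the four indices this gives 4, which turns \<open>1/2 * f R\<close>
    into \<open>2 * f R\<close>.\<close>
  have inv: "ginv g x $ \<mu> $ \<mu> * g x $ \<mu> $ \<mu> = 1" for \<mu>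
  proof -
    have "\<forall>\<mu>. ginv g x $ \<mu> $ \<mu> * g x $ \<mu> $ \<mu> = 1"
      using chartD[OF x] by (simp add: forall_4 ginv_g[OF x] diag4_nth sep_metric_def)
    then show ?thesis by blast
  qed
  have "R = (\<Sum>\<mu>\<in>UNIV. ginv g x $ \<mu> $ \<mu> * ricci g x $ \<mu> $ \<mu>)"
    by (simp add: ricci_scalar_def sum_4 ginv_g[OF x] diag4_nth flip: R)
  then have "deriv f R * R - 2 * f R =
      deriv f R * (\<Sum>\<mu>\<in>UNIV. ginv g x $ \<mu> $ \<mu> * ricci g x $ \<mu> $ \<mu>)
      - 1/2 * f R * (\<Sum>\<mu>\<in>UNIV. ginv g x $ \<mu> $ \<mu> * g x $ \<mu> $ \<mu>)"
    by (simp add: inv)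
  also have "\<dots> = (\<Sum>\<mu>\<in>UNIV. ginv g x $ \<mu> $ \<mu> *
      (deriv f R * ricci g x $ \<mu> $ \<mu> - 1/2 * f R * g x $ \<mu> $ \<mu>))"
    by (simp add: sum_distrib_left sum_subtractf right_diff_distrib mult.left_commute)
  also have "\<dots> = - \<kappa> * (\<Sum>\<mu>\<in>UNIV. ginv g x $ \<mu> $ \<mu> * E x $ \<mu> $ \<mu>)"
    unfolding eq by (simp add: sum_distrib_left mult.left_commute)
  finally show ?thesis .
qed

end

section \<open>Geometry of a spherically symmetric hypersurface\<close>

lemma metric_product_diag4:
  assumes "g x = diag4 p q r s"
  shows "metric_product g x v w = p * v$1 * w$1 + q * v$2 * w$2 + r * v$3 * w$3 + s * v$4 * w$4"
  by (simp add: metric_product_def assms sum_4 diag4_nth)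

text \<open>The interior surface is the case of identical time and constant radius, so one
  computation serves both sides.\<close>

locale surface = separable_metric +
  fixes P :: "real set" and ts ts1 ts2 rs rs1 rs2 :: "real \<Rightarrow> real"
  assumes open_P: "open P"
    and ts: "\<tau> \<in> P \<Longrightarrow> (ts has_real_derivative ts1 \<tau>) (at \<tau>)"
    and ts1: "\<tau> \<in> P \<Longrightarrow> (ts1 has_real_derivative ts2 \<tau>) (at \<tau>)"
    and rs: "\<tau> \<in> P \<Longrightarrow> (rs has_real_derivative rs1 \<tau>) (at \<tau>)"
    and rs1: "\<tau> \<in> P \<Longrightarrow> (rs1 has_real_derivative rs2 \<tau>) (at \<tau>)"
    and ts_T: "\<tau> \<in> P \<Longrightarrow> ts \<tau> \<in> T" and rs_S: "\<tau> \<in> P \<Longrightarrow> rs \<tau> \<in> S"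
    and ts1_pos: "\<tau> \<in> P \<Longrightarrow> ts1 \<tau> > 0"
begin

abbreviation "\<Phi> \<equiv> exterior_embedding ts rs"

definition intrinsic_domain :: "(real ^ 3) set" where
  "intrinsic_domain = {y. y$1 \<in> P \<and> 0 < y$2 \<and> y$2 < pi}"

lemma open_intrinsic_domain: "open intrinsic_domain"
proof -
  have "intrinsic_domain = (\<lambda>x. x$1) -` P \<inter> (\<lambda>x. x$2) -` {0<..<pi}"
    by (auto simp: intrinsic_domain_def)
  also have "open \<dots>"
    by (intro open_Int open_vimage open_P open_greaterThanLessThan continuous_intros)
  finally show ?thesis .
qed

lemma embedding_chart:
  assumes "y \<in> intrinsic_domain"
  shows "\<Phi> y \<in> chart"
  using assms ts_T rs_S by (auto simp: intrinsic_domain_def chart_def exterior_embedding_def vec4_nth)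

lemma embedding_nth [simp]:
  "\<Phi> y $ 1 = ts (y$1)" "\<Phi> y $ 2 = rs (y$1)" "\<Phi> y $ 3 = y$2" "\<Phi> y $ 4 = y$3"
  by (simp_all add: exterior_embedding_def vec4_nth)

lemma pd_intrinsic_1:
  assumes "(\<phi> has_real_derivative d) (at (y$1))"
  shows "pd 1 (\<lambda>z::real^3. \<phi> (z$1)) y = d"
  by (rule pd_eq_deriv[OF assms]) (simp add: axis_nth)

lemma tangent_embedding:
  assumes "y \<in> intrinsic_domain"
  shows "tangent \<Phi> 1 y = vec4 (ts1 (y$1)) (rs1 (y$1)) 0 0"
    "tangent \<Phi> 2 y = vec4 0 0 1 0" "tangent \<Phi> 3 y = vec4 0 0 0 1"
proof -
  have P: "y$1 \<in> P"
    using assms by (simp add: intrinsic_domain_def)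
  have 1: "pd 1 (\<lambda>z::real^3. z$2) y = 0" "pd 1 (\<lambda>z::real^3. z$3) y = 0"
    "pd 2 (\<lambda>z::real^3. ts (z$1)) y = 0" "pd 2 (\<lambda>z::real^3. rs (z$1)) y = 0"
    "pd 2 (\<lambda>z::real^3. z$3) y = 0" "pd 3 (\<lambda>z::real^3. z$2) y = 0"
    "pd 3 (\<lambda>z::real^3. ts (z$1)) y = 0" "pd 3 (\<lambda>z::real^3. rs (z$1)) y = 0"
    by (simp_all add: pd_def axis_nth)
  have 2: "pd 2 (\<lambda>z::real^3. z$2) y = 1" "pd 3 (\<lambda>z::real^3. z$3) y = 1"
    by (rule pd_eq_deriv[of "\<lambda>x. x"]; simp add: axis_nth)+
  note 3 = pd_intrinsic_1[OF ts[OF P]] pd_intrinsic_1[OF rs[OF P]]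
  show "tangent \<Phi> 1 y = vec4 (ts1 (y$1)) (rs1 (y$1)) 0 0"
    "tangent \<Phi> 2 y = vec4 0 0 1 0" "tangent \<Phi> 3 y = vec4 0 0 0 1"
    by (simp_all add: tangent_def vec_eq_iff forall_4 vec4_nth 1 2 3)
qed

lemmas metric_product_g = metric_product_diag4[of g, OF sep_metric_def]

lemma induced_metric_1_1:
  assumes "y \<in> intrinsic_domain"
  shows "induced_metric g \<Phi> 1 1 y =
    A (rs (y$1)) * (ts1 (y$1))\<^sup>2 - b (ts (y$1)) * B (rs (y$1)) * (rs1 (y$1))\<^sup>2"
  by (simp add: induced_metric_def metric_product_g tangent_embedding[OF assms] vec4_nth
      power2_eq_square)

lemma induced_metric_2_2:
  assumes "y \<in> intrinsic_domain"
  shows "induced_metric g \<Phi> 2 2 y = - (c (ts (y$1)) * C (rs (y$1)))"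
  by (simp add: induced_metric_def metric_product_g tangent_embedding[OF assms] vec4_nth)

end

text \<open>Here \<tau> is proper time along the surface. In the interior this is immediate; in the
  exterior it will follow from the matching of the induced metrics.\<close>

locale unit_speed_surface = surface +
  assumes unit_speed: "\<tau> \<in> P \<Longrightarrow> A (rs \<tau>) * (ts1 \<tau>)\<^sup>2 - b (ts \<tau>) * B (rs \<tau>) * (rs1 \<tau>)\<^sup>2 = 1"
begin

text \<open>The area density of the \<open>(t, r)\<close> block, the root of minus its determinant.
  It is \<open>sqrt V\<close> outside and \<open>a / sqrt (1 - k \<chi>s^2)\<close> inside.\<close>

definition area :: "real \<Rightarrow> real" where
  "area \<tau> = sqrt (A (rs \<tau>) * (b (ts \<tau>) * B (rs \<tau>)))"

text \<open>In a Lorentzian plane the normal is obtained from the unit tangent by swapping its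
  components and rescaling with the metric and the area density.\<close>

lemma unit_normal_g:
  assumes "y \<in> intrinsic_domain"
  defines "\<tau> \<equiv> y$1"
  shows "unit_normal g \<Phi> y = vec4 (area \<tau> * rs1 \<tau> / A (rs \<tau>))
    (area \<tau> * ts1 \<tau> / (b (ts \<tau>) * B (rs \<tau>))) 0 0"
proof -
  define p q u w where "p = A (rs \<tau>)" and "q = b (ts \<tau>) * B (rs \<tau>)"
    and "u = ts1 \<tau>" and "w = rs1 \<tau>"
  define N where "N = area \<tau>"
  have P: "\<tau> \<in> P"
    using assms by (simp add: intrinsic_domain_def)
  note D = chartD[OF embedding_chart[OF assms(1)], simplified, folded \<tau>_def]
  have pq: "p > 0" "q > 0" "u > 0"
    using D ts1_pos[OF P] by (auto simp: p_def q_def u_def)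
  have N: "N > 0" "N\<^sup>2 = p * q"
    using pq by (simp_all add: N_def area_def p_def q_def)
  have us: "p * u\<^sup>2 - q * w\<^sup>2 = 1"
    using unit_speed[OF P] by (simp add: p_def q_def u_def w_def)
  \<comment> \<open>Orthogonality to the two angular tangents removes the angular components and
    leaves a problem in the \<open>(t, r)\<close> plane.\<close>
  have char: "((\<forall>a. metric_product g (\<Phi> y) n (tangent \<Phi> a y) = 0) \<and>
             metric_product g (\<Phi> y) n n = -1 \<and> n $ 2 > 0)
    \<longleftrightarrow> p * n$1 * u = q * n$2 * w \<and> n$3 = 0 \<and> n$4 = 0 \<and> p * (n$1)\<^sup>2 - q * (n$2)\<^sup>2 = -1 \<and> n$2 > 0" for n
    using D
    by (auto simp: forall_3 metric_product_g tangent_embedding[OF assms(1)] vec4_nth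
        p_def q_def u_def w_def power2_eq_square simp flip: \<tau>_def)
  let ?n = "vec4 (N * w / p) (N * u / q) 0 0"
  have "p * (N * w / p)\<^sup>2 - q * (N * u / q)\<^sup>2 = - (N\<^sup>2 / (p * q)) * (p * u\<^sup>2 - q * w\<^sup>2)"
    using pq by (simp add: field_simps power2_eq_square)
  also have "\<dots> = - 1"
    using N pq us by simp
  finally have 1: "p * (?n$1)\<^sup>2 - q * (?n$2)\<^sup>2 = -1"
    by (simp add: vec4_nth)
  have "n = ?n" if n: "p * n$1 * u = q * n$2 * w" "n$3 = 0" "n$4 = 0"
    "p * (n$1)\<^sup>2 - q * (n$2)\<^sup>2 = -1" "n$2 > 0" for n
  proof -
    have n1: "n$1 = q * n$2 * w / (p * u)"
      using n(1) pq by (simp add: field_simps)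
    \<comment> \<open>After elimination of \<open>n$1\<close> both brackets equal 1, by unit speed
      and by normalisation. This fixes \<open>n$2\<close> up to sign, and \<open>n$2 > 0\<close>
      selects the root.\<close>
    have "(q * n$2)\<^sup>2 * (p * u\<^sup>2 - q * w\<^sup>2) = p * q * u\<^sup>2 * (q * (n$2)\<^sup>2 - p * (n$1)\<^sup>2)"
      using pq by (simp add: n1 field_simps power2_eq_square)
    also have "q * (n$2)\<^sup>2 - p * (n$1)\<^sup>2 = 1"
      using n(4) by linarith
    also have "p * q * u\<^sup>2 * 1 = (N * u)\<^sup>2"
      using N by (simp add: power_mult_distrib)
    finally have "(q * n$2)\<^sup>2 = (N * u)\<^sup>2"
      by (simp add: us)
    then have "q * n$2 = N * u"
      using pq N n(5) by (subst (asm) power2_eq_iff_nonneg) auto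
    then have "n$2 = N * u / q" "n$1 = N * w / p"
      using pq n1 by (simp_all add: field_simps)
    then show ?thesis
      by (simp add: vec_eq_iff forall_4 vec4_nth n)
  qed
  moreover have "p * ?n$1 * u = q * ?n$2 * w \<and> ?n$3 = 0 \<and> ?n$4 = 0 \<and> ?n$2 > 0"
    using pq N by (simp add: vec4_nth)
  ultimately have "unit_normal g \<Phi> y = ?n"
    unfolding unit_normal_def char using 1 by (intro the_equality) blast+
  then show ?thesis
    by (simp add: N_def p_def q_def u_def w_def)
qed

lemma unit_conormal_g:
  assumes "y \<in> intrinsic_domain"
  shows "unit_conormal g \<Phi> y = vec4 (area (y$1) * rs1 (y$1)) (- (area (y$1) * ts1 (y$1))) 0 0"
proof -
  note D = chartD[OF embedding_chart[OF assms(1)], simplified]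
  show ?thesis
    using D unfolding unit_conormal_def unit_normal_g[OF assms] sep_metric_def
    by (simp add: vec_eq_iff forall_4 matrix_vector_mult_def sum_4 diag4_nth vec4_nth)
qed

lemma normal_derivative_g:
  assumes "y \<in> intrinsic_domain"
  defines "\<tau> \<equiv> y$1"
  shows "normal_derivative g \<Phi> F y =
    area \<tau> * rs1 \<tau> / A (rs \<tau>) * pd 1 F (\<Phi> y)
    + area \<tau> * ts1 \<tau> / (b (ts \<tau>) * B (rs \<tau>)) * pd 2 F (\<Phi> y)"
  by (simp add: normal_derivative_def sum_4 unit_normal_g[OF assms(1)] vec4_nth \<tau>_def)

text \<open>The conormal has no angular component, so its derivative does not contribute; only the
  symbols with lower indices \<theta>\<theta> remain.\<close>

lemma extrinsic_curvature_2_2: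
  assumes "y \<in> intrinsic_domain"
  defines "\<tau> \<equiv> y$1"
  shows "extrinsic_curvature g \<Phi> 2 2 y =
    area \<tau> * (- (c1 (ts \<tau>) * C (rs \<tau>) / (2 * A (rs \<tau>))) * rs1 \<tau>
       - c (ts \<tau>) * C1 (rs \<tau>) / (2 * b (ts \<tau>) * B (rs \<tau>)) * ts1 \<tau>)"
proof -
  have "pd 2 (\<lambda>z. unit_conormal g \<Phi> z $ 3) y = 0"
    by (rule pd_locally_const[OF open_intrinsic_domain assms(1)]) (simp add: unit_conormal_g vec4_nth)
  then show ?thesis
    by (simp add: extrinsic_curvature_def sum_4 tangent_embedding[OF assms(1)] vec4_nth
        unit_conormal_g[OF assms(1)] christoffel_g[OF embedding_chart[OF assms(1)]] christoffel_table_def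
        algebra_simps flip: \<tau>_def)
qed

text \<open>Existence suffices: the derivative \<open>d\<close> of the density enters
  \<open>extrinsic_curvature_1_1\<close> as \<open>u * (d * w) - w * (d * u)\<close>, which is
  0.\<close>

lemma area_differentiable:
  assumes "\<tau> \<in> P"
  obtains d where "(area has_real_derivative d) (at \<tau>)"
proof -
  have "A (rs \<tau>) * (b (ts \<tau>) * B (rs \<tau>)) > 0"
    using pos_S pos_T ts_T[OF assms] rs_S[OF assms] by simp
  from DERIV_chain2[OF DERIV_real_sqrt[OF this]
      DERIV_mult[OF DERIV_chain2[OF A[OF rs_S[OF assms]] rs[OF assms]]
        DERIV_mult[OF DERIV_chain2[OF b[OF ts_T[OF assms]] ts[OF assms]]
          DERIV_chain2[OF B[OF rs_S[OF assms]] rs[OF assms]]]]]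
  show ?thesis
    using that unfolding area_def[abs_def] by blast
qed

text \<open>The bracket is \<open>u * q2 - w * q1\<close> for the covariant acceleration
  \<open>(q1, q2)\<close> of the curve \<open>(ts, rs)\<close>, so the component vanishes exactly
  when the normal acceleration does.\<close>

lemma extrinsic_curvature_1_1:
  assumes "y \<in> intrinsic_domain"
  defines "\<tau> \<equiv> y$1"
  defines "u \<equiv> ts1 \<tau>" and "w \<equiv> rs1 \<tau>" and "r \<equiv> rs \<tau>" and "t \<equiv> ts \<tau>"
  shows "extrinsic_curvature g \<Phi> 1 1 y =
    area \<tau> * (u * rs2 \<tau> - w * ts2 \<tau>
      - w * (A1 r / A r * u * w + b1 t * B r / (2 * A r) * w\<^sup>2)
      + u * (A1 r / (2 * b t * B r) * u\<^sup>2 + b1 t / b t * u * w + B1 r / (2 * B r) * w\<^sup>2))"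
proof -
  have P: "\<tau> \<in> P"
    using assms by (simp add: intrinsic_domain_def)
  obtain d where d: "(area has_real_derivative d) (at \<tau>)"
    using area_differentiable[OF P] .
  have "pd 1 (\<lambda>z. unit_conormal g \<Phi> z $ 1) y = pd 1 (\<lambda>z. area (z$1) * rs1 (z$1)) y"
    by (rule pd_cong[OF open_intrinsic_domain assms(1)]) (simp add: unit_conormal_g vec4_nth)
  also have "\<dots> = d * w + rs2 \<tau> * area \<tau>"
    unfolding w_def \<tau>_def
    by (rule pd_intrinsic_1) (rule DERIV_mult[OF d rs1[OF P], unfolded \<tau>_def])
  finally have 1: "pd 1 (\<lambda>z. unit_conormal g \<Phi> z $ 1) y = d * w + rs2 \<tau> * area \<tau>" .
  have "pd 1 (\<lambda>z. unit_conormal g \<Phi> z $ 2) y = pd 1 (\<lambda>z. - (area (z$1) * ts1 (z$1))) y"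
    by (rule pd_cong[OF open_intrinsic_domain assms(1)]) (simp add: unit_conormal_g vec4_nth)
  also have "\<dots> = - (d * u + ts2 \<tau> * area \<tau>)"
    unfolding u_def \<tau>_def
    by (rule pd_intrinsic_1[where \<phi> = "\<lambda>s. - (area s * ts1 s)"])
      (rule DERIV_minus[OF DERIV_mult[OF d ts1[OF P]], unfolded \<tau>_def])
  finally have 2: "pd 1 (\<lambda>z. unit_conormal g \<Phi> z $ 2) y = - (d * u + ts2 \<tau> * area \<tau>)" .
  show ?thesis
    by (simp add: extrinsic_curvature_def sum_4 tangent_embedding[OF assms(1)] vec4_nth
        unit_conormal_g[OF assms(1)] christoffel_g[OF embedding_chart[OF assms(1)]] christoffel_table_def 1 2
        flip: \<tau>_def u_def w_def r_def t_def)
      (simp add: algebra_simps power2_eq_square)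
qed

end

section \<open>The interior\<close>

text \<open>Three orders are extracted because the exterior Ricci scalar contains the second
  derivative of \<open>U\<close> and is differentiated once more.\<close>

lemma smooth_onE:
  assumes "smooth_on S f"
  obtains W where "open W" "S \<subseteq> W"
    "\<And>x. x \<in> W \<Longrightarrow> (f has_real_derivative deriv f x) (at x)"
    "\<And>x. x \<in> W \<Longrightarrow> (deriv f has_real_derivative deriv (deriv f) x) (at x)"
    "\<And>x. x \<in> W \<Longrightarrow> (deriv (deriv f) has_real_derivative deriv (deriv (deriv f)) x) (at x)"
proof -
  obtain W where W: "open W" "S \<subseteq> W" "\<And>n x. x \<in> W \<Longrightarrow> (deriv ^^ n) f differentiable (at x)"
    using assms unfolding smooth_on_def by blast
  have "((deriv ^^ n) f has_real_derivative deriv ((deriv ^^ n) f) x) (at x)" if "x \<in> W" for n x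
    using W(3)[OF that, of n] DERIV_deriv_iff_real_differentiable by blast
  from this[of _ 0] this[of _ 1] this[of _ 2] show ?thesis
    using that[OF W(1,2)] by (simp add: numeral_2_eq_2)
qed

locale dust_interior =
  fixes k \<tau>c \<chi>s :: real and a :: "real \<Rightarrow> real"
  assumes \<chi>s: "\<chi>s > 0" "1 - k * \<chi>s\<^sup>2 > 0"
    and a: "\<tau> \<in> {0<..<\<tau>c} \<Longrightarrow> (a has_real_derivative deriv a \<tau>) (at \<tau>)"
    and a1: "\<tau> \<in> {0<..<\<tau>c} \<Longrightarrow> (deriv a has_real_derivative deriv (deriv a) \<tau>) (at \<tau>)"
    and a_pos: "\<tau> \<in> {0<..<\<tau>c} \<Longrightarrow> a \<tau> > 0"

text \<open>The radial set is an open set around \<open>\<chi>s\<close>, to which the metric formula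
  extends. Thus two-sided derivatives make sense on the surface itself.\<close>

sublocale dust_interior \<subseteq> unit_speed_surface "{r. 0 < r \<and> 0 < 1 - k * r\<^sup>2}" "{0<..<\<tau>c}"
  "\<lambda>_. 1" "\<lambda>_. 0" "\<lambda>_. 0" "\<lambda>r. 1 / (1 - k * r\<^sup>2)" "\<lambda>r. 2 * k * r / (1 - k * r\<^sup>2)\<^sup>2"
  "\<lambda>r. r\<^sup>2" "\<lambda>r. 2 * r" "\<lambda>_. 2"
  "\<lambda>\<tau>. (a \<tau>)\<^sup>2" "\<lambda>\<tau>. 2 * a \<tau> * deriv a \<tau>" "\<lambda>\<tau>. 2 * (deriv a \<tau>)\<^sup>2 + 2 * a \<tau> * deriv (deriv a) \<tau>"
  "\<lambda>\<tau>. (a \<tau>)\<^sup>2" "\<lambda>\<tau>. 2 * a \<tau> * deriv a \<tau>" "\<lambda>\<tau>. 2 * (deriv a \<tau>)\<^sup>2 + 2 * a \<tau> * deriv (deriv a) \<tau>"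
  "{0<..<\<tau>c}" "\<lambda>\<tau>. \<tau>" "\<lambda>_. 1" "\<lambda>_. 0" "\<lambda>_. \<chi>s" "\<lambda>_. 0" "\<lambda>_. 0"
proof unfold_locales
  have "open ({r::real. 0 < r} \<inter> {r. 0 < 1 - k * r\<^sup>2})"
    by (intro open_Int open_Collect_less continuous_intros)
  then show "open {r. 0 < r \<and> 0 < 1 - k * r\<^sup>2}"
    by (simp add: Collect_conj_eq)
next
  fix \<tau> assume \<tau>: "\<tau> \<in> {0<..<\<tau>c}"
  note [derivative_intros] = a[OF \<tau>] a1[OF \<tau>]
  show "((\<lambda>\<tau>. (a \<tau>)\<^sup>2) has_real_derivative 2 * a \<tau> * deriv a \<tau>) (at \<tau>)"
    by (auto intro!: derivative_eq_intros)
  show "((\<lambda>\<tau>. 2 * a \<tau> * deriv a \<tau>) has_real_derivative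
      2 * (deriv a \<tau>)\<^sup>2 + 2 * a \<tau> * deriv (deriv a) \<tau>) (at \<tau>)"
    by (auto intro!: derivative_eq_intros simp: power2_eq_square)
next
  fix r assume "r \<in> {r. 0 < r \<and> 0 < 1 - k * r\<^sup>2}"
  then show "((\<lambda>r. 1 / (1 - k * r\<^sup>2)) has_real_derivative 2 * k * r / (1 - k * r\<^sup>2)\<^sup>2) (at r)"
    by (auto intro!: derivative_eq_intros simp: power2_eq_square)
qed (auto intro!: derivative_eq_intros simp: \<chi>s[simplified] less_imp_neq[OF a_pos, symmetric])

context dust_interior begin

lemma interior_metric_eq: "interior_metric k a = g"
  by (simp add: fun_eq_iff interior_metric_def sep_metric_def)

lemma interior_embedding_eq: "interior_embedding \<chi>s = \<Phi>"
  by (simp add: fun_eq_iff interior_embedding_def exterior_embedding_def)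

lemma interior_ricci_scalar:
  assumes "x \<in> chart"
  shows "ricci_scalar (interior_metric k a) x =
    6 * (((deriv a (x$1))\<^sup>2 + k) / (a (x$1))\<^sup>2 + deriv (deriv a) (x$1) / a (x$1))"
proof -
  note D = chartD[OF assms]
  have "a (x$1) > 0" "x$2 > 0" "1 - k * (x$2)\<^sup>2 > 0"
    using D a_pos by auto
  then show ?thesis
    unfolding interior_metric_eq ricci_scalar_g[OF assms] ricci_1_1[OF assms] ricci_2_2[OF assms]
      ricci_sphere_def
    apply (simp add: divide_simps)
    apply (simp add: algebra_simps power2_eq_square)
    done
qed

lemma interior_area: "\<tau> \<in> {0<..<\<tau>c} \<Longrightarrow> area \<tau> = a \<tau> / sqrt (1 - k * \<chi>s\<^sup>2)"
  using a_pos[of \<tau>] by (simp add: area_def real_sqrt_divide)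

text \<open>Comoving dust lines are geodesics, hence the first value. The second supplies the
  constant \<open>\<beta> = sqrt (1 - k * \<chi>s^2)\<close> of the exterior argument, as
  \<open>a * \<chi>s\<close> will turn out to be \<open>rs\<close>.\<close>

lemma interior_extrinsic_curvature:
  assumes "y \<in> intrinsic_domain"
  shows "extrinsic_curvature (interior_metric k a) (interior_embedding \<chi>s) 1 1 y = 0"
    "extrinsic_curvature (interior_metric k a) (interior_embedding \<chi>s) 2 2 y =
       - (sqrt (1 - k * \<chi>s\<^sup>2) * (a (y$1) * \<chi>s))"
proof -
  have y: "y$1 \<in> {0<..<\<tau>c}" "a (y$1) > 0"
    using assms a_pos by (auto simp: intrinsic_domain_def)
  show "extrinsic_curvature (interior_metric k a) (interior_embedding \<chi>s) 1 1 y = 0"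
    by (simp add: interior_metric_eq interior_embedding_eq extrinsic_curvature_1_1[OF assms])
  have "sqrt (1 - k * \<chi>s\<^sup>2) * sqrt (1 - k * \<chi>s\<^sup>2) = 1 - k * \<chi>s\<^sup>2"
    using \<chi>s by simp
  then show "extrinsic_curvature (interior_metric k a) (interior_embedding \<chi>s) 2 2 y =
       - (sqrt (1 - k * \<chi>s\<^sup>2) * (a (y$1) * \<chi>s))"
    using y \<chi>s
    by (simp add: interior_metric_eq interior_embedding_eq extrinsic_curvature_2_2[OF assms]
        interior_area[OF y(1)] divide_simps)
qed

text \<open>The surface is at rest in comoving coordinates, so its normal is purely radial, while
  the curvature depends on time only.\<close>

lemma interior_normal_derivative:
  assumes "y \<in> intrinsic_domain"
  shows "normal_derivative (interior_metric k a) (interior_embedding \<chi>s)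
    (ricci_scalar (interior_metric k a)) y = 0"
proof -
  define H where
    "H \<tau> = 6 * (((deriv a \<tau>)\<^sup>2 + k) / (a \<tau>)\<^sup>2 + deriv (deriv a) \<tau> / a \<tau>)" for \<tau>
  have "pd 2 (ricci_scalar g) (\<Phi> y) = pd 2 (\<lambda>x. H (x$1)) (\<Phi> y)"
    by (rule pd_cong[OF open_chart embedding_chart[OF assms]])
      (simp add: H_def interior_ricci_scalar flip: interior_metric_eq)
  also have "\<dots> = 0"
    by (rule pd_2) simp
  finally show ?thesis
    by (simp add: interior_metric_eq interior_embedding_eq normal_derivative_g[OF assms])
qed

lemma interior_induced_metric:
  assumes "y \<in> intrinsic_domain"
  shows "induced_metric (interior_metric k a) (interior_embedding \<chi>s) 1 1 y = 1"
    "induced_metric (interior_metric k a) (interior_embedding \<chi>s) 2 2 y = - (a (y$1) * \<chi>s)\<^sup>2"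
  by (simp_all add: interior_metric_eq interior_embedding_eq induced_metric_1_1[OF assms]
      induced_metric_2_2[OF assms] power_mult_distrib)

text \<open>The trace of the dust tensor is \<rho>, since \<open>u\<close> is a unit vector.\<close>

lemma interior_trace:
  assumes y: "y \<in> intrinsic_domain"
    and R: "\<And>x. x \<in> chart \<Longrightarrow> ricci_scalar (interior_metric k a) x = R"
    and eqs: "fR_equations \<kappa> f (interior_metric k a)
      (dust_tensor (interior_metric k a) \<rho> (\<lambda>x. axis 1 1)) (interior_embedding \<chi>s y)"
  shows "deriv f R * R - 2 * f R = - \<kappa> * \<rho> (interior_embedding \<chi>s y)"
proof -
  note x = embedding_chart[OF y]
  have "(\<Sum>\<mu>\<in>UNIV. ginv g (\<Phi> y) $ \<mu> $ \<mu> * dust_tensor g \<rho> (\<lambda>x. axis 1 1) (\<Phi> y) $ \<mu> $ \<mu>) = \<rho> (\<Phi> y)"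
    by (simp add: sum_4 ginv_g[OF x] diag4_nth dust_tensor_def matrix_vector_mult_def axis_nth
        sep_metric_def)
  then show ?thesis
    using fR_trace_const_curvature[OF x open_chart x R[unfolded interior_metric_eq]
        eqs[unfolded interior_metric_eq interior_embedding_eq]]
    by (simp add: interior_embedding_eq)
qed

end

section \<open>The exterior\<close>

text \<open>Pure algebra at one point, with \<open>u\<close>, \<open>w\<close> the velocities of
  \<open>ts\<close>, \<open>rs\<close>. The acceleration vanishes in both the normal and the
  tangential direction, so \<open>t\<close> obeys its geodesic equation. There \<open>V1\<close>
  enters the derivative of \<open>U u\<close> with the sign opposite to that in the differentiated
  \<open>energy\<close>; hence it is 0.\<close>

lemma geodesic_static:
  fixes U U1 V V1 u u2 w w2 \<beta> :: real
  assumes pos: "U > 0" "V > 0" "u > 0"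
    and unit: "U * u\<^sup>2 - V / U * w\<^sup>2 = 1"
    and unit': "U1 * w * u\<^sup>2 + 2 * U * u * u2 - (V1 * u * w\<^sup>2 + 2 * V * w * w2) / U
      + V * w ^ 3 * U1 / U\<^sup>2 = 0"
    and energy: "U\<^sup>2 * u\<^sup>2 = \<beta>\<^sup>2 * V"
    and energy': "2 * U * U1 * w * u\<^sup>2 + 2 * U\<^sup>2 * u * u2 = \<beta>\<^sup>2 * V1 * u"
    and normal: "u * w2 - w * u2 - w * (U1 / U * u * w + V1 / (2 * U\<^sup>2) * w\<^sup>2)
      + u * (U * U1 / (2 * V) * u\<^sup>2 + V1 / V * u * w - U1 / (2 * U) * w\<^sup>2) = 0"
  shows "V1 = 0"
proof -
  \<comment> \<open>the covariant acceleration of the surface as a curve in the \<open>(t, r)\<close>-plane\<close>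
  define q1 q2 where "q1 = u2 + U1 / U * u * w + V1 / (2 * U\<^sup>2) * w\<^sup>2"
    and "q2 = w2 + U * U1 / (2 * V) * u\<^sup>2 + V1 / V * u * w - U1 / (2 * U) * w\<^sup>2"
  have n: "u * q2 = w * q1"
    using normal by (simp add: q1_def q2_def algebra_simps)
  \<comment> \<open>The derivative of the squared length of the velocity is twice its product with
    the acceleration.\<close>
  have "2 * (U * u * q1 - V / U * w * q2) = U1 * w * u\<^sup>2 + 2 * U * u * u2
      - (V1 * u * w\<^sup>2 + 2 * V * w * w2) / U + V * w ^ 3 * U1 / U\<^sup>2"
    using pos by (simp add: q1_def q2_def field_simps power2_eq_square power3_eq_cube)
  then have t: "U * u * q1 = V / U * w * q2"
    using unit' by simp
  have "q1 = q1 * (U * u\<^sup>2 - V / U * w\<^sup>2)"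
    by (simp only: unit mult_1_right)
  also have "\<dots> = u * (U * u * q1) - V / U * w * (w * q1)"
    by (simp add: algebra_simps power2_eq_square)
  also have "\<dots> = 0"
    by (simp add: t flip: n)
  finally have q1: "q1 = 0" .
  \<comment> \<open>The factor \<open>V\<close> lets \<open>energy\<close> eliminate
    \<beta>.\<close>
  have "u * (V * (2 * U * U1 * w * u + 2 * U\<^sup>2 * u2)) = V * (\<beta>\<^sup>2 * V1 * u)"
    unfolding energy'[symmetric] by (simp add: algebra_simps power2_eq_square)
  also have "\<dots> = u * (U\<^sup>2 * u\<^sup>2 * V1)"
    unfolding energy by (simp add: algebra_simps)
  finally have "V * (2 * U * U1 * w * u + 2 * U\<^sup>2 * u2) = U\<^sup>2 * u\<^sup>2 * V1"
    using pos by simp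
  moreover have "V * (2 * U * U1 * w * u + 2 * U\<^sup>2 * u2) = - (V * V1 * w\<^sup>2) + 2 * U\<^sup>2 * V * q1"
    using pos by (simp add: q1_def field_simps power2_eq_square)
  ultimately have "V1 * (U\<^sup>2 * u\<^sup>2 + V * w\<^sup>2) = 0"
    by (simp add: q1 algebra_simps)
  moreover have "U\<^sup>2 * u\<^sup>2 + V * w\<^sup>2 > 0"
    using pos by (intro add_pos_nonneg) simp_all
  ultimately show ?thesis by simp
qed

locale exterior_surface =
  fixes S T P :: "real set" and U V ts rs :: "real \<Rightarrow> real"
  assumes opens: "open S" "open T" "open P" and S_pos: "S \<subseteq> {0<..}"
    and U: "r \<in> S \<Longrightarrow> (U has_real_derivative deriv U r) (at r)"
      "r \<in> S \<Longrightarrow> (deriv U has_real_derivative deriv (deriv U) r) (at r)"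
      "r \<in> S \<Longrightarrow> (deriv (deriv U) has_real_derivative deriv (deriv (deriv U)) r) (at r)"
    and U_pos: "r \<in> S \<Longrightarrow> U r > 0"
    and V: "t \<in> T \<Longrightarrow> (V has_real_derivative deriv V t) (at t)"
      "t \<in> T \<Longrightarrow> (deriv V has_real_derivative deriv (deriv V) t) (at t)"
    and V_pos: "t \<in> T \<Longrightarrow> V t > 0"
    and ts': "\<tau> \<in> P \<Longrightarrow> (ts has_real_derivative deriv ts \<tau>) (at \<tau>)"
      "\<tau> \<in> P \<Longrightarrow> (deriv ts has_real_derivative deriv (deriv ts) \<tau>) (at \<tau>)"
    and rs': "\<tau> \<in> P \<Longrightarrow> (rs has_real_derivative deriv rs \<tau>) (at \<tau>)"
      "\<tau> \<in> P \<Longrightarrow> (deriv rs has_real_derivative deriv (deriv rs) \<tau>) (at \<tau>)"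
    and images: "ts ` P \<subseteq> T" "rs ` P \<subseteq> S" and deriv_ts: "\<tau> \<in> P \<Longrightarrow> deriv ts \<tau> > 0"

sublocale exterior_surface \<subseteq> surface S T U "deriv U" "deriv (deriv U)"
  "\<lambda>r. 1 / U r" "\<lambda>r. - deriv U r / (U r)\<^sup>2" "\<lambda>r. r\<^sup>2" "\<lambda>r. 2 * r" "\<lambda>_. 2"
  V "deriv V" "deriv (deriv V)" "\<lambda>_. 1" "\<lambda>_. 0" "\<lambda>_. 0"
  P ts "deriv ts" "deriv (deriv ts)" rs "deriv rs" "deriv (deriv rs)"
proof unfold_locales
  fix r assume r: "r \<in> S"
  show "((\<lambda>r. 1 / U r) has_real_derivative - deriv U r / (U r)\<^sup>2) (at r)"
    using U_pos[OF r] U(1)[OF r]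
    by (auto intro!: derivative_eq_intros simp: power2_eq_square)
  show "(r::real)\<^sup>2 > 0"
    using r S_pos by auto
qed (use images in \<open>auto intro!: derivative_eq_intros opens U U_pos V V_pos ts' rs' deriv_ts\<close>)

context exterior_surface begin

lemma exterior_metric_eq: "exterior_metric U V = g"
  by (simp add: fun_eq_iff exterior_metric_def sep_metric_def)

text \<open>With both time derivatives gone, \<open>V\<close> only rescales the radial part of the
  metric.\<close>

lemma exterior_ricci_scalar:
  assumes "x \<in> chart" "deriv V (x$1) = 0" "deriv (deriv V) (x$1) = 0"
  defines "r \<equiv> x$2"
  shows "ricci_scalar (exterior_metric U V) x =
    2 / r\<^sup>2 - (deriv (deriv U) r + 4 * deriv U r / r + 2 * U r / r\<^sup>2) / V (x$1)"
proof -
  have "U r > 0" "V (x$1) > 0" "r > 0"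
    using chartD[OF assms(1)] S_pos by (auto simp: r_def)
  then show ?thesis
    unfolding exterior_metric_eq ricci_scalar_g[OF assms(1)] ricci_1_1[OF assms(1)]
      ricci_2_2[OF assms(1)] ricci_sphere_def assms(2,3)
    by (simp add: field_simps power2_eq_square flip: r_def)
qed

lemma exterior_induced_metric:
  assumes "y \<in> intrinsic_domain"
  shows "induced_metric (exterior_metric U V) (exterior_embedding ts rs) 1 1 y =
      U (rs (y$1)) * (deriv ts (y$1))\<^sup>2 - V (ts (y$1)) * (1 / U (rs (y$1))) * (deriv rs (y$1))\<^sup>2"
    "induced_metric (exterior_metric U V) (exterior_embedding ts rs) 2 2 y = - (rs (y$1))\<^sup>2"
  by (simp_all add: exterior_metric_eq induced_metric_1_1[OF assms] induced_metric_2_2[OF assms])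

lemma exterior_trace:
  assumes "y \<in> intrinsic_domain" "open D" "exterior_embedding ts rs y \<in> D"
    and "\<And>x. x \<in> D \<Longrightarrow> ricci_scalar (exterior_metric U V) x = R"
    and "fR_equations \<kappa> f (exterior_metric U V) (\<lambda>x. 0) (exterior_embedding ts rs y)"
  shows "deriv f R * R - 2 * f R = 0"
  using fR_trace_const_curvature[OF embedding_chart[OF assms(1)] assms(2,3)
      assms(4,5)[unfolded exterior_metric_eq]]
  by simp

end

text \<open>Kept apart from \<open>exterior_surface\<close>, whose formula for the induced metric is
  what establishes the unit speed in the first place.\<close>

locale unit_speed_exterior = exterior_surface +
  assumes exterior_unit_speed:
    "\<tau> \<in> P \<Longrightarrow> U (rs \<tau>) * (deriv ts \<tau>)\<^sup>2 - V (ts \<tau>) * (1 / U (rs \<tau>)) * (deriv rs \<tau>)\<^sup>2 = 1"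

sublocale unit_speed_exterior \<subseteq> unit_speed_surface S T U "deriv U" "deriv (deriv U)"
  "\<lambda>r. 1 / U r" "\<lambda>r. - deriv U r / (U r)\<^sup>2" "\<lambda>r. r\<^sup>2" "\<lambda>r. 2 * r" "\<lambda>_. 2"
  V "deriv V" "deriv (deriv V)" "\<lambda>_. 1" "\<lambda>_. 0" "\<lambda>_. 0"
  P ts "deriv ts" "deriv (deriv ts)" rs "deriv rs" "deriv (deriv rs)"
  by unfold_locales (rule exterior_unit_speed)

context unit_speed_exterior begin

text \<open>\<open>K22\<close> yields the energy relation and \<open>K11\<close> the vanishing
  normal acceleration. Differentiating the energy relation and the unit speed condition along the
  surface provides the other inputs of \<open>geodesic_static\<close>.\<close>

lemma deriv_V_eq_0:
  assumes K11: "\<And>y. y \<in> intrinsic_domain \<Longrightarrow>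
      extrinsic_curvature (exterior_metric U V) (exterior_embedding ts rs) 1 1 y = 0"
    and K22: "\<And>y. y \<in> intrinsic_domain \<Longrightarrow>
      extrinsic_curvature (exterior_metric U V) (exterior_embedding ts rs) 2 2 y = - (\<beta> * rs (y$1))"
    and \<tau>: "\<tau> \<in> P"
  shows "deriv V (ts \<tau>) = 0"
proof -
  \<comment> \<open>An equatorial point of the surface at time \<open>s\<close>, away from the
    axis.\<close>
  define pt :: "real \<Rightarrow> real ^ 3" where "pt s = (\<chi> i. if i = 1 then s else pi / 2)" for s
  have pt: "pt s \<in> intrinsic_domain" "pt s $ 1 = s" if "s \<in> P" for s
    using that by (auto simp: pt_def intrinsic_domain_def)
  have pos: "U (rs s) > 0" "V (ts s) > 0" "rs s > 0" if "s \<in> P" for s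
    using that images U_pos V_pos S_pos by blast+
  have area: "area s = sqrt (V (ts s))" if "s \<in> P" for s
    using pos[OF that] by (simp add: area_def)
  have energy: "(U (rs s))\<^sup>2 * (deriv ts s)\<^sup>2 = \<beta>\<^sup>2 * V (ts s)" if s: "s \<in> P" for s
  proof -
    have "sqrt (V (ts s)) * (rs s * U (rs s) * deriv ts s / V (ts s)) = \<beta> * rs s"
      using K22[OF pt(1)[OF s]] pos[OF s]
      by (simp add: exterior_metric_eq extrinsic_curvature_2_2[OF pt(1)[OF s]] pt(2)[OF s] area[OF s])
    then have "U (rs s) * deriv ts s * sqrt (V (ts s)) = \<beta> * V (ts s)"
      using pos[OF s] by (simp add: field_simps)
    then have "(U (rs s) * deriv ts s * sqrt (V (ts s)))\<^sup>2 = (\<beta> * V (ts s))\<^sup>2"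
      by simp
    moreover have "(U (rs s) * deriv ts s * sqrt (V (ts s)))\<^sup>2 =
        ((U (rs s))\<^sup>2 * (deriv ts s)\<^sup>2) * V (ts s)"
      using pos[OF s] by (simp add: power_mult_distrib)
    moreover have "(\<beta> * V (ts s))\<^sup>2 = (\<beta>\<^sup>2 * V (ts s)) * V (ts s)"
      by (simp add: power2_eq_square)
    ultimately show ?thesis
      using pos[OF s] by simp
  qed
  have const_deriv: "d = 0" if "(F has_real_derivative d) (at \<tau>)" "\<And>s. s \<in> P \<Longrightarrow> F s = e"
    for F :: "real \<Rightarrow> real" and d e
  proof (rule DERIV_unique[OF that(1)])
    show "(F has_real_derivative 0) (at \<tau>)"
      by (rule has_field_derivative_transform_within_open[OF DERIV_const[of e] open_P \<tau>])
        (simp add: that(2))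
  qed
  note [derivative_intros] = ts'[OF \<tau>] rs'[OF \<tau>] DERIV_chain2[OF U(1)[OF rs_S[OF \<tau>]] rs'(1)[OF \<tau>]]
    DERIV_chain2[OF V(1)[OF ts_T[OF \<tau>]] ts'(1)[OF \<tau>]]
  define u u2 w w2 Ur U1 Vt V1 where "u = deriv ts \<tau>" and "u2 = deriv (deriv ts) \<tau>"
    and "w = deriv rs \<tau>" and "w2 = deriv (deriv rs) \<tau>"
    and "Ur = U (rs \<tau>)" and "U1 = deriv U (rs \<tau>)" and "Vt = V (ts \<tau>)" and "V1 = deriv V (ts \<tau>)"
  note defs = u_def u2_def w_def w2_def Ur_def U1_def Vt_def V1_def
  have posr: "Ur > 0" "Vt > 0" "u > 0"
    using pos[OF \<tau>] deriv_ts[OF \<tau>] by (simp_all add: defs)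
  have "((\<lambda>s. U (rs s) * (deriv ts s)\<^sup>2 - V (ts s) * (1 / U (rs s)) * (deriv rs s)\<^sup>2)
      has_real_derivative U1 * w * u\<^sup>2 + 2 * Ur * u * u2 - (V1 * u * w\<^sup>2 + 2 * Vt * w * w2) / Ur
      + Vt * w ^ 3 * U1 / Ur\<^sup>2) (at \<tau>)"
    using posr by (auto intro!: derivative_eq_intros simp flip: defs)
       (simp add: field_simps power2_eq_square power3_eq_cube)
  then have unit': "U1 * w * u\<^sup>2 + 2 * Ur * u * u2 - (V1 * u * w\<^sup>2 + 2 * Vt * w * w2) / Ur
      + Vt * w ^ 3 * U1 / Ur\<^sup>2 = 0"
    by (rule const_deriv) (rule exterior_unit_speed)
  have "((\<lambda>s. (U (rs s))\<^sup>2 * (deriv ts s)\<^sup>2 - \<beta>\<^sup>2 * V (ts s)) has_real_derivative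
      2 * Ur * U1 * w * u\<^sup>2 + 2 * Ur\<^sup>2 * u * u2 - \<beta>\<^sup>2 * V1 * u) (at \<tau>)"
    by (auto intro!: derivative_eq_intros simp flip: defs)
  then have energy': "2 * Ur * U1 * w * u\<^sup>2 + 2 * Ur\<^sup>2 * u * u2 - \<beta>\<^sup>2 * V1 * u = 0"
    by (rule const_deriv[where e = 0]) (simp add: energy)
  have "u * w2 - w * u2 - w * (U1 / Ur * u * w + V1 / (2 * Ur\<^sup>2) * w\<^sup>2)
      + u * (Ur * U1 / (2 * Vt) * u\<^sup>2 + V1 / Vt * u * w - U1 / (2 * Ur) * w\<^sup>2) = 0"
  proof -
    have "area \<tau> \<noteq> 0"
      using area[OF \<tau>] pos[OF \<tau>] by simp
    \<comment> \<open>The terms keep the unsimplified shape of the instance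
      \<open>B = 1 / U\<close>, so that cancelling \<open>area\<close> yields them
      literally.\<close>
    then have "u * w2 - w * u2
        - w * (U1 / Ur * u * w + V1 * (1 / Ur) / (2 * Ur) * w\<^sup>2)
        + u * (U1 / (2 * Vt * (1 / Ur)) * u\<^sup>2 + V1 / Vt * u * w
          + - U1 / Ur\<^sup>2 / (2 * (1 / Ur)) * w\<^sup>2) = 0"
      using K11[OF pt(1)[OF \<tau>]]
      unfolding exterior_metric_eq extrinsic_curvature_1_1[OF pt(1)[OF \<tau>]] pt(2)[OF \<tau>]
        defs[symmetric] mult_eq_0_iff by blast
    then show ?thesis
      using posr by (simp add: field_simps power2_eq_square)
  qed
  from geodesic_static[OF posr _ unit' _ _ this, of \<beta>] show ?thesis
    using exterior_unit_speed[OF \<tau>] energy[OF \<tau>] energy' by (simp add: defs)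
qed

text \<open>Constancy on the surface alone would not suffice for the field equations, which
  differentiate \<open>R\<close>. The images of \<open>ts\<close> and \<open>rs\<close> are open
  intervals, and on the box \<open>D\<close> over them \<open>R\<close> depends on \<open>r\<close>
  only.\<close>

lemma exterior_const_curvature:
  assumes P: "is_interval P" "inj_on rs P"
    and V1: "\<And>\<tau>. \<tau> \<in> P \<Longrightarrow> deriv V (ts \<tau>) = 0"
    and normal: "\<And>y. y \<in> intrinsic_domain \<Longrightarrow> normal_derivative (exterior_metric U V) (exterior_embedding ts rs)
      (ricci_scalar (exterior_metric U V)) y = 0"
  obtains R D where "open D" "\<And>y. y \<in> intrinsic_domain \<Longrightarrow> exterior_embedding ts rs y \<in> D"
    "\<And>x. x \<in> D \<Longrightarrow> ricci_scalar (exterior_metric U V) x = R"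
proof -
  have convex: "convex P"
    using P(1) by (simp add: is_interval_convex)
  have "ts x < ts y" if "x \<in> P" "y \<in> P" "x < y" for x y
  proof (rule DERIV_pos_imp_increasing[OF that(3)])
    fix s assume "x \<le> s" "s \<le> y"
    then have "s \<in> P"
      using mem_is_interval_1_I[OF P(1) that(1,2)] by blast
    then show "\<exists>d. DERIV ts s :> d \<and> d > 0"
      using ts'(1) deriv_ts by blast
  qed
  then have "inj_on ts P"
    by (intro linorder_inj_onI) (auto simp: less_le)
  moreover have "continuous_on P ts" "continuous_on P rs"
    by (auto intro!: continuous_at_imp_continuous_on DERIV_isCont[OF ts'(1)] DERIV_isCont[OF rs'(1)])
  ultimately have open_ts: "open (ts ` P)" and open_rs: "open (rs ` P)"
    using injective_into_1d_imp_open_map_UNIV[OF open_P _ _ order_refl] P(2) by blast+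
  have V2: "deriv (deriv V) (ts \<tau>) = 0" if "\<tau> \<in> P" for \<tau>
  proof (rule DERIV_unique[OF V(2)])
    show "(deriv V has_real_derivative 0) (at (ts \<tau>))"
      by (rule has_field_derivative_transform_within_open[OF DERIV_const[of 0] open_ts])
        (use that V1 in auto)
  qed (use that ts_T in auto)
  have "((\<lambda>\<tau>. V (ts \<tau>)) has_real_derivative 0) (at \<tau> within P)" if "\<tau> \<in> P" for \<tau>
    using DERIV_chain2[OF V(1)[OF ts_T[OF that]] ts'(1)[OF that]] V1[OF that]
    by (auto intro: has_field_derivative_at_within)
  then obtain v where v: "\<And>\<tau>. \<tau> \<in> P \<Longrightarrow> V (ts \<tau>) = v"
    using has_field_derivative_zero_constant[OF convex, of "\<lambda>\<tau>. V (ts \<tau>)"] by blast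
  define H where "H r = 2 / r\<^sup>2 - (deriv (deriv U) r + 4 * deriv U r / r + 2 * U r / r\<^sup>2) / v" for r
  define D where "D = {x \<in> chart. x$1 \<in> ts ` P \<and> x$2 \<in> rs ` P}"
  have "D = chart \<inter> (\<lambda>x. x$1) -` ts ` P \<inter> (\<lambda>x. x$2) -` rs ` P"
    by (auto simp: D_def)
  then have D: "open D"
    by (simp only:) (intro open_Int open_vimage open_chart open_ts open_rs continuous_intros)
  have \<Phi>D: "\<Phi> y \<in> D" if "y \<in> intrinsic_domain" for y
    using embedding_chart[OF that] that by (auto simp: D_def intrinsic_domain_def)
  have RH: "ricci_scalar g x = H (x$2)" if "x \<in> D" for x
    using that V1 V2 v exterior_ricci_scalar[of x]
    by (auto simp: D_def H_def simp flip: exterior_metric_eq)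
  have dH: "\<exists>d. (H has_real_derivative d) (at r)" if r: "r \<in> S" for r
  proof -
    have "r \<noteq> 0"
      using r S_pos by auto
    then show ?thesis
      unfolding H_def[abs_def] divide_inverse[of _ v]
      using U[OF r]
      by (intro exI) (rule derivative_eq_intros refl | assumption | simp)+
  qed
  have "((\<lambda>\<tau>. H (rs \<tau>)) has_real_derivative 0) (at \<tau> within P)" if \<tau>: "\<tau> \<in> P" for \<tau>
  proof -
    define y :: "real ^ 3" where "y = (\<chi> i. if i = 1 then \<tau> else pi / 2)"
    have y: "y \<in> intrinsic_domain" "y$1 = \<tau>"
      using \<tau> by (auto simp: y_def intrinsic_domain_def)
    obtain d where d: "(H has_real_derivative d) (at (rs \<tau>))"
      using dH rs_S[OF \<tau>] by blast
    have "pd 1 (ricci_scalar g) (\<Phi> y) = pd 1 (\<lambda>x. H (x$2)) (\<Phi> y)"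
      by (rule pd_cong[OF D \<Phi>D[OF y(1)] RH])
    also have "\<dots> = 0"
      by (rule pd_1) simp
    finally have 1: "pd 1 (ricci_scalar g) (\<Phi> y) = 0" .
    have "pd 2 (ricci_scalar g) (\<Phi> y) = pd 2 (\<lambda>x. H (x$2)) (\<Phi> y)"
      by (rule pd_cong[OF D \<Phi>D[OF y(1)] RH])
    also have "\<dots> = d"
      by (rule pd_2) (simp add: y(2) d)
    finally have 2: "pd 2 (ricci_scalar g) (\<Phi> y) = d" .
    have "area \<tau> \<noteq> 0" "U (rs \<tau>) \<noteq> 0" "V (ts \<tau>) \<noteq> 0" "deriv ts \<tau> \<noteq> 0"
      using U_pos[OF rs_S[OF \<tau>]] V_pos[OF ts_T[OF \<tau>]] deriv_ts[OF \<tau>] by (auto simp: area_def)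
    \<comment> \<open>Since \<open>R\<close> has no \<open>t\<close>-derivative here, the normal
      derivative is a nonzero multiple of \<open>d\<close>.\<close>
    then have "d = 0"
      using normal[OF y(1)]
      by (simp add: exterior_metric_eq normal_derivative_g[OF y(1)] 1 2 y(2))
    then show ?thesis
      using DERIV_chain2[OF d rs'(1)[OF \<tau>]] by (auto intro: has_field_derivative_at_within)
  qed
  then obtain R where "\<And>\<tau>. \<tau> \<in> P \<Longrightarrow> H (rs \<tau>) = R"
    using has_field_derivative_zero_constant[OF convex, of "\<lambda>\<tau>. H (rs \<tau>)"] by blast
  then have "ricci_scalar g x = R" if "x \<in> D" for x
    using RH[OF that] that by (auto simp: D_def)
  with D \<Phi>D show ?thesis
    by (intro that) (auto simp: exterior_metric_eq)
qed

end

section \<open>The no-go theorem\<close>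

theorem mainTheorem5:
  fixes \<kappa> k \<rho>0 \<chi>s \<tau>c :: real and J :: "real set" and f a :: "real \<Rightarrow> real"
  assumes "\<kappa> > 0"
    and "nonlinear_fR_model J f"
    and "collapsing_dust_star \<kappa> J f k \<rho>0 \<chi>s \<tau>c a"
  shows "\<not> (\<exists>(It :: real set) (Ir :: real set) (U :: real \<Rightarrow> real) (V :: real \<Rightarrow> real)
              (ts :: real \<Rightarrow> real) (rs :: real \<Rightarrow> real).
            vacuum_exterior \<kappa> J f \<tau>c It Ir U V ts rs \<and>
            smoothly_matched_fR (surface_domain \<tau>c)
              (exterior_metric U V) (exterior_embedding ts rs)
              (interior_metric k a) (interior_embedding \<chi>s))"
proof (intro notI, elim exE conjE)
  fix It Ir :: "real set" and U V ts rs :: "real \<Rightarrow> real"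
  assume ext: "vacuum_exterior \<kappa> J f \<tau>c It Ir U V ts rs"
    and matched: "smoothly_matched_fR (surface_domain \<tau>c) (exterior_metric U V)
      (exterior_embedding ts rs) (interior_metric k a) (interior_embedding \<chi>s)"
  let ?P = "{0<..<\<tau>c}" and ?gp = "exterior_metric U V" and ?\<Phi>p = "exterior_embedding ts rs"
    and ?gm = "interior_metric k a" and ?\<Phi>m = "interior_embedding \<chi>s"
  note star = assms(3)[unfolded collapsing_dust_star_def]
  note ext = ext[unfolded vacuum_exterior_def]
  obtain Wa where Wa: "{0..<\<tau>c} \<subseteq> Wa"
    "\<And>x. x \<in> Wa \<Longrightarrow> (a has_real_derivative deriv a x) (at x)"
    "\<And>x. x \<in> Wa \<Longrightarrow> (deriv a has_real_derivative deriv (deriv a) x) (at x)"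
    using star by (auto elim: smooth_onE)
  interpret I: dust_interior k \<tau>c \<chi>s a
    using star by unfold_locales (auto intro!: Wa(2,3) subsetD[OF Wa(1)])
  obtain WU where WU: "open WU" "Ir \<subseteq> WU"
    "\<And>x. x \<in> WU \<Longrightarrow> (U has_real_derivative deriv U x) (at x)"
    "\<And>x. x \<in> WU \<Longrightarrow> (deriv U has_real_derivative deriv (deriv U) x) (at x)"
    "\<And>x. x \<in> WU \<Longrightarrow> (deriv (deriv U) has_real_derivative deriv (deriv (deriv U)) x) (at x)"
    using ext smooth_onE[of Ir U] by metis
  obtain WV where WV: "open WV" "It \<subseteq> WV"
    "\<And>x. x \<in> WV \<Longrightarrow> (V has_real_derivative deriv V x) (at x)"
    "\<And>x. x \<in> WV \<Longrightarrow> (deriv V has_real_derivative deriv (deriv V) x) (at x)"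
    using ext smooth_onE[of It V] by metis
  obtain Wts where Wts: "{0..<\<tau>c} \<subseteq> Wts"
    "\<And>x. x \<in> Wts \<Longrightarrow> (ts has_real_derivative deriv ts x) (at x)"
    "\<And>x. x \<in> Wts \<Longrightarrow> (deriv ts has_real_derivative deriv (deriv ts) x) (at x)"
    using ext smooth_onE[of "{0..<\<tau>c}" ts] by metis
  obtain Wrs where Wrs: "{0..<\<tau>c} \<subseteq> Wrs"
    "\<And>x. x \<in> Wrs \<Longrightarrow> (rs has_real_derivative deriv rs x) (at x)"
    "\<And>x. x \<in> Wrs \<Longrightarrow> (deriv rs has_real_derivative deriv (deriv rs) x) (at x)"
    using ext smooth_onE[of "{0..<\<tau>c}" rs] by metis
  \<comment> \<open>Positivity is given on \<open>Ir\<close> and \<open>It\<close> only; by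
    continuity it persists on open neighbourhoods, which the charts require.\<close>
  define S T where "S = WU \<inter> U -` {0<..} \<inter> {0<..}" and "T = WV \<inter> V -` {0<..}"
  have "open (WU \<inter> U -` {0<..})" "open T"
    unfolding T_def using WU WV
    by (auto intro!: continuous_open_preimage continuous_at_imp_continuous_on DERIV_isCont)
  then have ST: "open S" "open T" "Ir \<subseteq> S" "It \<subseteq> T"
    using ext WU(2) WV(2) by (auto simp: S_def T_def)
  have sub: "ts ` ?P \<subseteq> It" "rs ` ?P \<subseteq> Ir" "?P \<subseteq> Wts" "?P \<subseteq> Wrs"
    using ext Wts(1) Wrs(1) by fastforce+
  have E: "exterior_surface S T ?P U V ts rs"
    using ST sub WU WV Wts Wrs ext
    by unfold_locales (auto simp: S_def T_def)
  \<comment> \<open>This set depends on the parameter interval only, so it serves the exterior as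
    well.\<close>
  have I_domain: "I.intrinsic_domain = {y. 0 < y$1 \<and> y$1 < \<tau>c \<and> 0 < y$2 \<and> y$2 < pi}"
    by (auto simp: I.intrinsic_domain_def)
  define pt :: "real \<Rightarrow> real ^ 3" where "pt s = (\<chi> i. if i = 1 then s else pi / 2)" for s
  have pt: "pt s \<in> I.intrinsic_domain" "pt s $ 1 = s" if "s \<in> ?P" for s
    using that by (auto simp: pt_def I_domain)
  have sub_dom: "I.intrinsic_domain \<subseteq> surface_domain \<tau>c"
    by (auto simp: I_domain surface_domain_def)
  note match = matched[unfolded smoothly_matched_fR_def, rule_format, OF subsetD[OF sub_dom]]
  have h11: "U (rs \<tau>) * (deriv ts \<tau>)\<^sup>2 - V (ts \<tau>) * (1 / U (rs \<tau>)) * (deriv rs \<tau>)\<^sup>2 = 1"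
    and rs: "rs \<tau> = a \<tau> * \<chi>s" if \<tau>: "\<tau> \<in> ?P" for \<tau>
  proof -
    note h = exterior_surface.exterior_induced_metric[OF E pt(1)[OF \<tau>]]
      I.interior_induced_metric[OF pt(1)[OF \<tau>]]
    show "U (rs \<tau>) * (deriv ts \<tau>)\<^sup>2 - V (ts \<tau>) * (1 / U (rs \<tau>)) * (deriv rs \<tau>)\<^sup>2 = 1"
      using match[OF pt(1)[OF \<tau>]] h by (simp add: pt(2)[OF \<tau>])
    have "(rs \<tau>)\<^sup>2 = (a \<tau> * \<chi>s)\<^sup>2"
      using match[OF pt(1)[OF \<tau>]] h by (simp add: pt(2)[OF \<tau>])
    moreover have "rs \<tau> \<in> Ir" "a \<tau> * \<chi>s > 0"
      using sub(2) \<tau> I.a_pos[OF \<tau>] I.\<chi>s by auto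
    moreover have "Ir \<subseteq> {0<..}"
      using ext by blast
    ultimately show "rs \<tau> = a \<tau> * \<chi>s"
      by (auto simp: power2_eq_iff)
  qed
  have E1: "unit_speed_exterior S T ?P U V ts rs"
    by (intro unit_speed_exterior.intro E unit_speed_exterior_axioms.intro h11)
  have V1: "deriv V (ts \<tau>) = 0" if "\<tau> \<in> ?P" for \<tau>
  proof (rule unit_speed_exterior.deriv_V_eq_0[OF E1 _ _ that])
    fix y assume y: "y \<in> I.intrinsic_domain"
    then have "rs (y$1) = a (y$1) * \<chi>s"
      by (intro rs) (simp add: I_domain)
    then show "extrinsic_curvature ?gp ?\<Phi>p 2 2 y = - (sqrt (1 - k * \<chi>s\<^sup>2) * rs (y$1))"
      using match[OF y] I.interior_extrinsic_curvature[OF y] by simp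
    show "extrinsic_curvature ?gp ?\<Phi>p 1 1 y = 0"
      using match[OF y] I.interior_extrinsic_curvature[OF y] by simp
  qed
  \<comment> \<open>Collapse enters here: it makes \<open>rs\<close> injective, so that the surface
    sweeps an open range of radii.\<close>
  have "a y < a x" if "x \<in> ?P" "y \<in> ?P" "x < y" for x y
  proof (rule DERIV_neg_imp_decreasing[OF that(3)])
    fix s assume "x \<le> s" "s \<le> y"
    then have "s \<in> ?P"
      using that by auto
    then show "\<exists>d. DERIV a s :> d \<and> d < 0"
      using I.a star by blast
  qed
  then have "inj_on a ?P"
    unfolding inj_on_def by (metis less_irrefl linorder_less_linear)
  then have inj: "inj_on rs ?P"
    using I.\<chi>s rs by (simp add: inj_on_def)
  obtain R D where D: "open D" "\<And>y. y \<in> I.intrinsic_domain \<Longrightarrow> ?\<Phi>p y \<in> D"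
    "\<And>x. x \<in> D \<Longrightarrow> ricci_scalar ?gp x = R"
  proof (rule unit_speed_exterior.exterior_const_curvature[OF E1 _ inj V1])
    fix y assume y: "y \<in> I.intrinsic_domain"
    show "normal_derivative ?gp ?\<Phi>p (ricci_scalar ?gp) y = 0"
      using match[OF y] I.interior_normal_derivative[OF y] by simp
  qed (auto simp: is_interval_oo)
  \<comment> \<open>By homogeneity \<open>x\<close> may be moved to the surface at the same time,
    where the curvatures of both sides agree.\<close>
  have R: "ricci_scalar ?gm x = R" if x: "x \<in> I.chart" for x
  proof -
    have \<tau>: "x$1 \<in> ?P"
      by (rule I.chartD(1)[OF x])
    note y = pt[OF \<tau>]
    have chart: "?\<Phi>m (pt (x$1)) \<in> I.chart"
      using I.embedding_chart[OF y(1)] unfolding I.interior_embedding_eq .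
    have "?\<Phi>m (pt (x$1)) $ 1 = x$1"
      by (simp only: I.interior_embedding_eq I.embedding_nth y(2))
    then have "ricci_scalar ?gm x = ricci_scalar ?gm (?\<Phi>m (pt (x$1)))"
      by (simp only: I.interior_ricci_scalar[OF x] I.interior_ricci_scalar[OF chart])
    also have "\<dots> = ricci_scalar ?gp (?\<Phi>p (pt (x$1)))"
      using match[OF y(1)] by simp
    also have "\<dots> = R"
      by (rule D(3)[OF D(2)[OF y(1)]])
    finally show ?thesis .
  qed
  \<comment> \<open>Any instant strictly inside the collapse would do. The surface belongs to both
    closed regions, so both sets of field equations hold at this point.\<close>
  define y where "y = pt (\<tau>c / 2)"
  have \<tau>: "\<tau>c / 2 \<in> ?P"
    using star by simp
  have y: "y \<in> I.intrinsic_domain" "y$1 = \<tau>c / 2" "0 < y$2" "y$2 < pi"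
    using pt[OF \<tau>] by (auto simp: y_def pt_def)
  have "?\<Phi>p y \<in> exterior_region Ir \<tau>c ts rs"
    using y \<tau> sub(2) by (auto simp: exterior_region_def exterior_embedding_def vec4_nth)
  then have "fR_equations \<kappa> f ?gp (\<lambda>x. 0) (?\<Phi>p y)"
    using ext by (simp add: solves_fR_def)
  then have "deriv f R * R - 2 * f R = 0"
    by (intro exterior_surface.exterior_trace[OF E y(1) D(1) D(2)[OF y(1)] D(3)])
  moreover have "?\<Phi>m y \<in> interior_region \<chi>s \<tau>c"
    using y \<tau> star by (auto simp: interior_region_def interior_embedding_def vec4_nth)
  then have "deriv f R * R - 2 * f R = - \<kappa> * (\<rho>0 / (a (?\<Phi>m y $ 1)) ^ 3)"
    using star by (intro I.interior_trace[OF y(1) R]) (auto simp: solves_fR_def)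
  moreover have "a (?\<Phi>m y $ 1) > 0"
    using I.a_pos[OF \<tau>] by (simp only: I.interior_embedding_eq I.embedding_nth y(2))
  \<comment> \<open>The same expression in \<open>R\<close> is 0 from outside and
    \<open>- \<kappa> * \<rho>0 / a^3 < 0\<close> from inside.\<close>
  ultimately show False
    using assms(1) star by simp
qed

end
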